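(* Let $C$ be an infinite, finitely based downward closed set of permutations under the consecutive subpermutation ordering, and let $b$ be the maximum length of a basis element of $C$. Then $C$ is atomic if and only if the following two conditions are satisfied: (i) the factor graph $\Gamma(C)$ is either strongly connected, or it is a bicycle with no ambiguous paths; and (ii) for each permutation $\sigma\in C$ with $|\sigma|<b$ there is a permutation $\rho\in C$ with $|\rho|=b$ which contains $\sigma$ as a contiguous subpermutation.
   Context: A permutation of length $n$ is a sequence of elements of $\{1,\dots,n\}$ in which every element appears exactly once; $|\sigma|$ is the length of $\sigma$ and $\sigma|_{[i,j]}$ is the subsequence of its entries in positions $i,\dots,j$. $S$ is the set of all finite permutations. For a finite sequence $\tau$ of distinct real numbers, $\operatorname{perm}(\tau)$ is the unique permutation of the same length whose entries are in the same relative order as those of $\tau$. $\sigma$ is a contiguous (consecutive) subpermutation of $\tau$, written $\sigma\le_f\tau$, if $\sigma=\operatorname{perm}(\tau|_{[i,i+|\sigma|-1]})$ for some $i$. $C\subseteq S$ is downward closed if $\tau\in C$, $\sigma\le_f\tau$ imply $\sigma\in C$. The basis of $C$ is the set of $\le_f$-minimal elements of $S\setminus C$; $C$ is finitely based if its basis is finite (and understood to be nonempty, so that $b$ is defined). $C$ is atomic if it is not the union of two proper downward closed subsets (equivalently, for all $x,y\in C$ there is $z\in C$ with $x,y\le_f z$). The factor graph $\Gamma(C)$ is the digraph whose vertices are the permutations of length $b$ in $C$, with an edge $\sigma\to\tau$ precisely when $\operatorname{perm}(\sigma|_{[2,b]})=\operatorname{perm}(\tau|_{[1,b-1]})$ (loops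 allowed). For a path $\pi=\tau_1\to\dots\to\tau_n$ in $\Gamma(C)$, let $\Sigma(\pi)$ be the set of all permutations $\sigma$ of length $n+b-1$ with $\operatorname{perm}(\sigma|_{[i,i+b-1]})=\tau_i$ for $i=1,\dots,n$. The path $\pi$ is ambiguous if $|\Sigma(\pi)|>1$. In a digraph, a path is a sequence $v_1\to\dots\to v_k$ ($k\ge1$) with an edge from $v_i$ to $v_{i+1}$ for each $i$ (vertices may repeat); it is simple if its vertices are distinct; a simple cycle is a path with $k\ge2$, $v_1=v_k$ and $v_1,\dots,v_{k-1}$ distinct. A digraph is strongly connected if for any two vertices $u,v$ there are paths from $u$ to $v$ and from $v$ to $u$. A bicycle is a digraph consisting precisely of two vertex-disjoint simple cycles $\pi_1$ (initial cycle) and $\pi_2$ (terminal cycle), connected by a simple directed path $\tau$ (connecting path) from a vertex of $\pi_1$ to a vertex of $\pi_2$, no internal vertex of which belongs to $\pi_1$ or $\pi_2$. Either or both of $\pi_1,\pi_2$ are allowed to be absent (so a simple path, or a simple cycle with a simple path leading into it or out of it and otherwise disjoint from it, are bicycles), and a single simple cycle is also a bicycle; but if both cycles are present they share no vertex. *)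

theory Defs
  imports "Graph_Theory.Graph_Theory"
begin

section \<open>Permutations as lists\<close>

text \<open>The empty list is the permutation of length 0.\<close>

definition is_permutation :: "nat list \<Rightarrow> bool" where
  "is_permutation \<sigma> \<longleftrightarrow> set \<sigma> = {1..length \<sigma>} \<and> distinct \<sigma>"

definition order_isomorphic :: "nat list \<Rightarrow> 'a::linorder list \<Rightarrow> bool" where
  "order_isomorphic \<sigma> \<tau> \<longleftrightarrow> length \<sigma> = length \<tau> \<and>
     (\<forall>i<length \<tau>. \<forall>j<length \<tau>. \<sigma> ! i < \<sigma> ! j \<longleftrightarrow> \<tau> ! i < \<tau> ! j)"

text \<open>Only meaningful for lists of distinct elements; see \<open>ex1_perm_of\<close> and \<open>perm_of_eq\<close> below.\<close>

definition perm_of :: "'a::linorder list \<Rightarrow> nat list" where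
  "perm_of \<tau> = (THE \<sigma>. is_permutation \<sigma> \<and> order_isomorphic \<sigma> \<tau>)"

text \<open>
  The entries of \<open>\<sigma>\<close> in positions \<open>i, \<dots>, j\<close>, where positions are counted from 1
  (whereas list indices are counted from 0).
\<close>

definition window :: "'a list \<Rightarrow> nat \<Rightarrow> nat \<Rightarrow> 'a list" where
  "window \<sigma> i j = nths \<sigma> {k. Suc k \<in> {i..j}}"

definition contiguous_le :: "nat list \<Rightarrow> nat list \<Rightarrow> bool" (infix \<open>\<le>\<^sub>f\<close> 50) where
  "\<sigma> \<le>\<^sub>f \<tau> \<longleftrightarrow> (\<exists>i\<ge>1. i + length \<sigma> - 1 \<le> length \<tau> \<and>
     \<sigma> = perm_of (window \<tau> i (i + length \<sigma> - 1)))"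

section \<open>Downward closed sets of permutations\<close>

definition downward_closed :: "nat list set \<Rightarrow> bool" where
  "downward_closed C \<longleftrightarrow> C \<subseteq> Collect is_permutation \<and>
     (\<forall>\<tau>\<in>C. \<forall>\<sigma>. is_permutation \<sigma> \<and> \<sigma> \<le>\<^sub>f \<tau> \<longrightarrow> \<sigma> \<in> C)"

definition basis :: "nat list set \<Rightarrow> nat list set" where
  "basis C = {\<sigma>. is_permutation \<sigma> \<and> \<sigma> \<notin> C \<and>
     (\<forall>\<tau>. is_permutation \<tau> \<and> \<tau> \<notin> C \<and> \<tau> \<le>\<^sub>f \<sigma> \<longrightarrow> \<tau> = \<sigma>)}"

definition finitely_based :: "nat list set \<Rightarrow> bool" where
  "finitely_based C \<longleftrightarrow> finite (basis C) \<and> basis C \<noteq> {}"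

definition atomic :: "nat list set \<Rightarrow> bool" where
  "atomic C \<longleftrightarrow> \<not> (\<exists>A B. downward_closed A \<and> downward_closed B \<and>
     A \<subset> C \<and> B \<subset> C \<and> C = A \<union> B)"

section \<open>Digraphs\<close>

text \<open>
  Paths are represented by their vertex sequences, so that a path is a \<^const>\<open>vwalk\<close> and a
  simple path is a \<^const>\<open>vpath\<close>. A loop at \<open>v\<close> is the simple cycle \<open>[v, v]\<close>.
\<close>

definition simple_cycle :: "'a list \<Rightarrow> 'a pair_pre_digraph \<Rightarrow> bool" where
  "simple_cycle p G \<longleftrightarrow> vwalk p (with_proj G) \<and> 2 \<le> length p \<and>
     hd p = last p \<and> distinct (butlast p)"

text \<open>
  An absent cycle is represented by the empty list. A single simple cycle is obtained by taking
  for \<open>\<tau>\<close> a path consisting of just one vertex of this cycle. When both cycles are present, the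
  conditions say that \<open>\<tau>\<close> starts on \<open>p\<close>, ends on \<open>q\<close>, and has no other vertex on \<open>p\<close> or \<open>q\<close>.
\<close>

definition bicycle :: "'a pair_pre_digraph \<Rightarrow> bool" where
  "bicycle G \<longleftrightarrow> (\<exists>p \<tau> q.
     (p = [] \<or> simple_cycle p G \<and> set \<tau> \<inter> set p = {hd \<tau>}) \<and>
     (q = [] \<or> simple_cycle q G \<and> set \<tau> \<inter> set q = {last \<tau>}) \<and>
     set p \<inter> set q = {} \<and>
     vpath \<tau> (with_proj G) \<and>
     pverts G = set p \<union> set \<tau> \<union> set q \<and>
     parcs G = set (vwalk_arcs p) \<union> set (vwalk_arcs \<tau>) \<union> set (vwalk_arcs q))"

section \<open>The factor graph\<close>

definition factor_graph :: "nat \<Rightarrow> nat list set \<Rightarrow> nat list pair_pre_digraph" where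
  "factor_graph b C =
    (let V = {\<sigma>\<in>C. length \<sigma> = b} in
     \<lparr> pverts = V,
       parcs = {(\<sigma>, \<tau>). \<sigma> \<in> V \<and> \<tau> \<in> V \<and>
                 perm_of (window \<sigma> 2 b) = perm_of (window \<tau> 1 (b - 1))} \<rparr>)"

text \<open>The set \<open>\<Sigma>(\<pi>)\<close>; in \<open>\<pi> ! (i - 1)\<close> the path is indexed from 1, like positions.\<close>

definition path_perms :: "nat \<Rightarrow> nat list list \<Rightarrow> nat list set" where
  "path_perms b \<pi> = {\<sigma>. is_permutation \<sigma> \<and> length \<sigma> = length \<pi> + b - 1 \<and>
     (\<forall>i\<in>{1..length \<pi>}. perm_of (window \<sigma> i (i + b - 1)) = \<pi> ! (i - 1))}"

definition ambiguous :: "nat \<Rightarrow> nat list list \<Rightarrow> bool" where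
  "ambiguous b \<pi> \<longleftrightarrow> card (path_perms b \<pi>) > 1"

section \<open>Well-definedness\<close>

lemma card_le_nth:
  assumes "is_permutation \<sigma>" "i < length \<sigma>"
  shows "card {j. j < length \<sigma> \<and> \<sigma> ! j \<le> \<sigma> ! i} = \<sigma> ! i"
proof -
  let ?J = "{j. j < length \<sigma> \<and> \<sigma> ! j \<le> \<sigma> ! i}"
  have S: "set \<sigma> = {1..length \<sigma>}" and D: "distinct \<sigma>"
    using assms(1) by (auto simp: is_permutation_def)
  have "\<sigma> ! i \<in> {1..length \<sigma>}" using S assms(2) nth_mem by blast
  then have "{1..\<sigma> ! i} \<subseteq> set \<sigma>" using S by auto
  then have "(!) \<sigma> ` ?J = {1..\<sigma> ! i}"
  proof (intro equalityI subsetI)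
    fix y assume "y \<in> (!) \<sigma> ` ?J"
    then obtain j where j: "j < length \<sigma>" "\<sigma> ! j \<le> \<sigma> ! i" "y = \<sigma> ! j" by blast
    then have "y \<in> set \<sigma>" by simp
    then show "y \<in> {1..\<sigma> ! i}" using S j by auto
  next
    fix y assume y: "y \<in> {1..\<sigma> ! i}"
    then obtain j where "j < length \<sigma>" "\<sigma> ! j = y"
      using \<open>{1..\<sigma> ! i} \<subseteq> set \<sigma>\<close> by (metis in_set_conv_nth subsetD)
    then show "y \<in> (!) \<sigma> ` ?J" using y by auto
  qed
  moreover have "inj_on ((!) \<sigma>) ?J" using D by (auto simp: inj_on_def nth_eq_iff_index_eq)
  ultimately show ?thesis using card_image by fastforce
qed

lemma order_isomorphic_rank:
  fixes \<tau> :: "'a::linorder list"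
  assumes "distinct \<tau>"
  defines "\<rho> \<equiv> map (\<lambda>x. card {y \<in> set \<tau>. y \<le> x}) \<tau>"
  shows "is_permutation \<rho>" and "order_isomorphic \<rho> \<tau>"
proof -
  let ?r = "\<lambda>x. card {y \<in> set \<tau>. y \<le> x}"
  have mono: "?r x < ?r y" if "x < y" "y \<in> set \<tau>" for x y
  proof (rule psubset_card_mono)
    have "y \<in> {z \<in> set \<tau>. z \<le> y} - {z \<in> set \<tau>. z \<le> x}" using that by auto
    moreover have "{z \<in> set \<tau>. z \<le> x} \<subseteq> {z \<in> set \<tau>. z \<le> y}" using that by auto
    ultimately show "{z \<in> set \<tau>. z \<le> x} \<subset> {z \<in> set \<tau>. z \<le> y}" by blast
  qed simp
  have iff: "?r x < ?r y \<longleftrightarrow> x < y" if "x \<in> set \<tau>" "y \<in> set \<tau>" for x y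
    using mono[of x y] mono[of y x] that by (cases x y rule: linorder_cases) auto
  have "inj_on ?r (set \<tau>)"
  proof (rule inj_onI)
    fix x y assume *: "x \<in> set \<tau>" "y \<in> set \<tau>" "?r x = ?r y"
    then show "x = y" using mono[of x y] mono[of y x] by (cases x y rule: linorder_cases) auto
  qed
  then have D: "distinct \<rho>" using assms(1) by (simp add: \<rho>_def distinct_map)
  have "?r x \<in> {1..length \<rho>}" if "x \<in> set \<tau>" for x
  proof -
    have "card {x} \<le> ?r x" using that by (intro card_mono) auto
    moreover have "?r x \<le> card (set \<tau>)" by (intro card_mono) auto
    ultimately show ?thesis using card_length[of \<tau>] by (auto simp: \<rho>_def)
  qed
  then have "set \<rho> \<subseteq> {1..length \<rho>}" by (auto simp: \<rho>_def)
  moreover have "card (set \<rho>) = card {1..length \<rho>}" using distinct_card[OF D] by simp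
  ultimately have "set \<rho> = {1..length \<rho>}" by (simp add: card_subset_eq)
  then show "is_permutation \<rho>" using D by (simp add: is_permutation_def)
  show "order_isomorphic \<rho> \<tau>" by (auto simp: order_isomorphic_def \<rho>_def iff)
qed

lemma order_isomorphic_unique:
  assumes "is_permutation \<sigma>" "order_isomorphic \<sigma> \<tau>"
    and "is_permutation \<sigma>'" "order_isomorphic \<sigma>' \<tau>"
  shows "\<sigma> = \<sigma>'"
proof (rule nth_equalityI)
  show len: "length \<sigma> = length \<sigma>'" using assms by (simp add: order_isomorphic_def)
  fix i assume i: "i < length \<sigma>"
  have "{j. j < length \<sigma> \<and> \<sigma> ! j \<le> \<sigma> ! i} = {j. j < length \<sigma>' \<and> \<sigma>' ! j \<le> \<sigma>' ! i}"
    using assms(2,4) i unfolding order_isomorphic_def by (auto simp flip: not_less)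
  then show "\<sigma> ! i = \<sigma>' ! i"
    using card_le_nth[OF assms(1) i] card_le_nth[OF assms(3), of i] i len by simp
qed

lemma ex1_perm_of:
  assumes "distinct \<tau>"
  shows "\<exists>!\<sigma>. is_permutation \<sigma> \<and> order_isomorphic \<sigma> \<tau>"
  using order_isomorphic_rank[OF assms] order_isomorphic_unique by blast

lemma perm_of_eq:
  assumes "distinct \<tau>"
  shows "perm_of \<tau> = map (\<lambda>x. card {y \<in> set \<tau>. y \<le> x}) \<tau>"
  unfolding perm_of_def
  using order_isomorphic_rank[OF assms] order_isomorphic_unique by blast

lemma window_eq_take_drop:
  assumes "1 \<le> i"
  shows "window \<sigma> i j = take (Suc j - i) (drop (i - 1) \<sigma>)"
proof -
  have *: "{k. i - 1 + k \<in> {k. Suc k \<in> {i..j}}} = {..<Suc j - i}" using assms by auto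
  have "nths \<sigma> {k. Suc k \<in> {i..j}}
      = nths (take (i - 1) \<sigma>) {k. Suc k \<in> {i..j}} @ nths (drop (i - 1) \<sigma>) {..<Suc j - i}"
  proof (cases "i - 1 \<le> length \<sigma>")
    case True
    then show ?thesis
      using nths_append[of "take (i - 1) \<sigma>" "drop (i - 1) \<sigma>" "{k. Suc k \<in> {i..j}}"] *
      by (simp add: add.commute min_def)
  next
    case False
    then show ?thesis by simp
  qed
  also have "nths (take (i - 1) \<sigma>) {k. Suc k \<in> {i..j}} = []"
    by (auto simp: nths_def filter_empty_conv set_zip)
  finally show ?thesis by (simp add: window_def)
qed

end

theory Submission
  imports Defs Complex_Main "HOL-Library.Sublist"
begin

text \<open>
  Atomicity is the joint embedding property: any two members of \<open>C\<close> lie in a common member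
  (\<open>atomic_iff_joint_embedding\<close>). Because no basis element is longer than \<open>b\<close>, a permutation of
  length at least \<open>b\<close> belongs to \<open>C\<close> exactly when all its length-\<open>b\<close> windows do; hence these
  members of \<open>C\<close> are the permutations whose sequence of windows is a walk in the factor graph.
  Linear orders that agree on an interval can be amalgamated, so two members joined by an arc of the
  factor graph can be glued to a member whose windows are the two walks put together (\<open>glue\<close>). In
  particular every walk comes from some member of \<open>C\<close>, and that member is unique precisely when
  the walk is not ambiguous. Joint embedding thus becomes a question about walks, and the condition on
  members shorter than \<open>b\<close> allows them to be replaced by members of length \<open>b\<close>.

  If the graph is strongly connected, then the walks of two members can be linked by a third one, and
  gluing along it embeds both. If every walk is unambiguous, a member whose walk contains two given
  walks contains both given members; so it suffices that any two walks lie in a common walk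
  (\<open>joint_walks\<close>).

  The graph theory consists of characterising finite digraphs with this property which are not
  strongly connected. Such a digraph has an arc \<open>(s, t)\<close> with no way back from \<open>t\<close> to \<open>s\<close>, which
  every walk can use at most once. Two walks through this arc that lie in a common walk must
  therefore be aligned along it, so that one can read the graph backwards from \<open>s\<close> and forwards
  from \<open>t\<close> in only one way (\<open>thin_bridge\<close>). In a finite graph a deterministic orbit is a path that
  stops or runs into a cycle; the backward orbit of \<open>s\<close> and the forward orbit of \<open>t\<close>, joined by
  the arc \<open>(s, t)\<close>, are a bicycle. Conversely, in a bicycle which is not strongly connected the
  first arc of the connecting path is such an arc.

  The same arc shows that joint embedding forbids ambiguity: two different permutations on one walk
  extend to different permutations on one walk through \<open>(s, t)\<close>, and a member of \<open>C\<close> containing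
  both would have to contain them at the same place.
\<close>

section \<open>Lists with the same relative order\<close>

text \<open>
  This extends \<^const>\<open>order_isomorphic\<close> to entries of two arbitrary types, since permutations are
  going to be compared with lists of reals.
\<close>

definition same_order :: "'a::linorder list \<Rightarrow> 'b::linorder list \<Rightarrow> bool" where
  "same_order xs ys \<longleftrightarrow> length xs = length ys \<and>
     (\<forall>i<length xs. \<forall>j<length xs. xs ! i < xs ! j \<longleftrightarrow> ys ! i < ys ! j)"

lemma order_isomorphic_iff_same_order: "order_isomorphic \<sigma> \<tau> \<longleftrightarrow> same_order \<sigma> \<tau>"
  by (auto simp: order_isomorphic_def same_order_def)

lemma same_order_sym: "same_order xs ys \<Longrightarrow> same_order ys xs"
  by (simp add: same_order_def)

lemma same_order_trans: "same_order xs ys \<Longrightarrow> same_order ys zs \<Longrightarrow> same_order xs zs"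
  by (simp add: same_order_def)

lemma same_order_take: "same_order xs ys \<Longrightarrow> same_order (take k xs) (take k ys)"
  by (simp add: same_order_def)

lemma same_order_drop: "same_order xs ys \<Longrightarrow> same_order (drop k xs) (drop k ys)"
  by (simp add: same_order_def)

lemma
  assumes "distinct \<tau>"
  shows is_permutation_perm_of: "is_permutation (perm_of \<tau>)"
    and same_order_perm_of: "same_order (perm_of \<tau>) \<tau>"
  using theI'[OF ex1_perm_of[OF assms]]
  by (simp_all add: perm_of_def order_isomorphic_iff_same_order)

lemma length_perm_of: "distinct \<tau> \<Longrightarrow> length (perm_of \<tau>) = length \<tau>"
  using same_order_perm_of by (auto simp: same_order_def)

lemma distinct_if_permutation: "is_permutation \<sigma> \<Longrightarrow> distinct \<sigma>"
  by (simp add: is_permutation_def)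

lemma perm_of_unique:
  assumes "distinct \<tau>" "is_permutation \<sigma>" "same_order \<sigma> \<tau>"
  shows "perm_of \<tau> = \<sigma>"
  using assms is_permutation_perm_of[OF assms(1)] same_order_perm_of[OF assms(1)]
  by (auto simp: order_isomorphic_iff_same_order intro: order_isomorphic_unique)

lemma perm_of_permutation: "is_permutation \<sigma> \<Longrightarrow> perm_of \<sigma> = \<sigma>"
  by (rule perm_of_unique) (simp_all add: is_permutation_def same_order_def)

lemma perm_of_eq_iff:
  assumes "distinct xs" "distinct ys"
  shows "perm_of xs = perm_of ys \<longleftrightarrow> same_order xs ys"
proof
  assume "perm_of xs = perm_of ys"
  then show "same_order xs ys"
    using same_order_perm_of assms by (metis same_order_sym same_order_trans)
next
  assume "same_order xs ys"
  then have "same_order (perm_of ys) xs"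
    using same_order_perm_of[OF assms(2)] by (meson same_order_sym same_order_trans)
  then show "perm_of xs = perm_of ys"
    using perm_of_unique[OF assms(1) is_permutation_perm_of[OF assms(2)]] by simp
qed

section \<open>Contiguous factors\<close>

text \<open>
  The index \<open>i\<close> counts from 0, unlike the positions of \<^const>\<open>window\<close>.
\<close>

definition factor :: "nat \<Rightarrow> nat \<Rightarrow> nat list \<Rightarrow> nat list" where
  "factor i k \<sigma> = perm_of (take k (drop i \<sigma>))"

lemma factor_perm_of:
  assumes "distinct w"
  shows "factor i k (perm_of w) = perm_of (take k (drop i w))"
proof -
  have "distinct (perm_of w)"
    using is_permutation_perm_of[OF assms] by (rule distinct_if_permutation)
  then show ?thesis
    unfolding factor_def
    by (subst perm_of_eq_iff)
      (simp_all add: assms same_order_take same_order_drop same_order_perm_of)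
qed

lemma is_permutation_factor: "is_permutation \<sigma> \<Longrightarrow> is_permutation (factor i k \<sigma>)"
  by (simp add: factor_def is_permutation_perm_of distinct_if_permutation)

lemma length_factor:
  "is_permutation \<sigma> \<Longrightarrow> i + k \<le> length \<sigma> \<Longrightarrow> length (factor i k \<sigma>) = k"
  by (simp add: factor_def length_perm_of distinct_if_permutation)

lemma factor_factor:
  assumes "is_permutation \<sigma>" "i' + k' \<le> k"
  shows "factor i' k' (factor i k \<sigma>) = factor (i + i') k' \<sigma>"
proof -
  have "factor i' k' (factor i k \<sigma>) = perm_of (take k' (drop i' (take k (drop i \<sigma>))))"
    unfolding factor_def[of i k] by (rule factor_perm_of) (simp add: distinct_if_permutation assms)
  also have "take k' (drop i' (take k (drop i \<sigma>))) = take k' (drop (i + i') \<sigma>)"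
    using assms(2) by (simp add: drop_take min_def add.commute)
  finally show ?thesis by (simp add: factor_def)
qed

lemma factor_all: "is_permutation \<sigma> \<Longrightarrow> factor 0 (length \<sigma>) \<sigma> = \<sigma>"
  by (simp add: factor_def perm_of_permutation)

lemma contiguous_le_iff_factor:
  "\<sigma> \<le>\<^sub>f \<tau> \<longleftrightarrow> (\<exists>i. i + length \<sigma> \<le> length \<tau> \<and> \<sigma> = factor i (length \<sigma>) \<tau>)"
proof
  assume "\<sigma> \<le>\<^sub>f \<tau>"
  then obtain i where i: "i \<ge> 1" "i + length \<sigma> - 1 \<le> length \<tau>"
      "\<sigma> = perm_of (window \<tau> i (i + length \<sigma> - 1))"
    by (auto simp: contiguous_le_def)
  moreover from i(1) have "Suc (i + length \<sigma> - 1) - i = length \<sigma>" by simp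
  ultimately show "\<exists>i. i + length \<sigma> \<le> length \<tau> \<and> \<sigma> = factor i (length \<sigma>) \<tau>"
    by (intro exI[of _ "i - 1"]) (simp add: window_eq_take_drop factor_def)
next
  assume "\<exists>i. i + length \<sigma> \<le> length \<tau> \<and> \<sigma> = factor i (length \<sigma>) \<tau>"
  then obtain i where "i + length \<sigma> \<le> length \<tau>" "\<sigma> = factor i (length \<sigma>) \<tau>" by blast
  then show "\<sigma> \<le>\<^sub>f \<tau>"
    unfolding contiguous_le_def
    by (intro exI[of _ "Suc i"]) (simp add: window_eq_take_drop factor_def)
qed

lemma factor_le:
  assumes "is_permutation \<sigma>" "i + k \<le> length \<sigma>"
  shows "factor i k \<sigma> \<le>\<^sub>f \<sigma>"
  using assms length_factor[OF assms] by (auto simp: contiguous_le_iff_factor)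

lemma contiguous_le_refl: "is_permutation \<sigma> \<Longrightarrow> \<sigma> \<le>\<^sub>f \<sigma>"
  using factor_le[of \<sigma> 0 "length \<sigma>"] by (simp add: factor_all)

lemma contiguous_le_length: "\<sigma> \<le>\<^sub>f \<tau> \<Longrightarrow> length \<sigma> \<le> length \<tau>"
  by (auto simp: contiguous_le_iff_factor)

lemma contiguous_le_trans:
  assumes "is_permutation \<upsilon>" "\<sigma> \<le>\<^sub>f \<tau>" "\<tau> \<le>\<^sub>f \<upsilon>"
  shows "\<sigma> \<le>\<^sub>f \<upsilon>"
proof -
  obtain i where i: "i + length \<sigma> \<le> length \<tau>" "\<sigma> = factor i (length \<sigma>) \<tau>"
    using assms(2) by (auto simp: contiguous_le_iff_factor)
  obtain j where j: "j + length \<tau> \<le> length \<upsilon>" "\<tau> = factor j (length \<tau>) \<upsilon>"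
    using assms(3) by (auto simp: contiguous_le_iff_factor)
  have "\<sigma> = factor (j + i) (length \<sigma>) \<upsilon>"
    using i(2) factor_factor[OF assms(1) i(1), of j] unfolding j(2)[symmetric] by simp
  then show ?thesis using i(1) j(1) by (auto simp: contiguous_le_iff_factor intro!: exI[of _ "j + i"])
qed

text \<open>
  An occurrence of \<open>\<sigma>\<close> is contained in a window of any length between that of \<open>\<sigma>\<close> and that of
  \<open>\<tau>\<close>.
\<close>

lemma le_some_factor:
  assumes "is_permutation \<tau>" "\<sigma> \<le>\<^sub>f \<tau>" "length \<sigma> \<le> k" "k \<le> length \<tau>"
  obtains i where "i + k \<le> length \<tau>" "\<sigma> \<le>\<^sub>f factor i k \<tau>"
proof -
  obtain i where i: "i + length \<sigma> \<le> length \<tau>" "\<sigma> = factor i (length \<sigma>) \<tau>"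
    using assms(2) by (auto simp: contiguous_le_iff_factor)
  \<comment> \<open>If the window starting where the occurrence starts overruns, the last window is taken instead.\<close>
  define j where "j = min i (length \<tau> - k)"
  have j: "j + k \<le> length \<tau>" "(i - j) + length \<sigma> \<le> k" "j \<le> i"
    using assms(3,4) i(1) by (auto simp: j_def)
  have "factor (i - j) (length \<sigma>) (factor j k \<tau>) = \<sigma>"
    using factor_factor[OF assms(1) j(2), of j] j(3) i(2) by simp
  then have "\<sigma> \<le>\<^sub>f factor j k \<tau>"
    using factor_le[OF is_permutation_factor[OF assms(1)], of "i - j" "length \<sigma>" j k] j
      length_factor[OF assms(1) j(1)] by simp
  then show thesis using that j(1) by blast
qed

lemma finite_permutations_length: "finite {\<sigma>. is_permutation \<sigma> \<and> length \<sigma> = n}"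
proof (rule finite_subset)
  show "{\<sigma>. is_permutation \<sigma> \<and> length \<sigma> = n} \<subseteq> {\<sigma>. set \<sigma> \<subseteq> {1..n} \<and> length \<sigma> = n}"
    by (auto simp: is_permutation_def)
qed (simp add: finite_lists_length_eq)

section \<open>Amalgamation of permutations\<close>

text \<open>
  The reals are dense and unbounded, so they have room for a new entry in any prescribed relative
  position. This is why permutations are amalgamated as lists of reals and normalised only at
  the end.
\<close>

lemma real_cut_avoiding:
  fixes L H A :: "real set"
  assumes "finite L" "finite H" "finite A" "\<And>l h. l \<in> L \<Longrightarrow> h \<in> H \<Longrightarrow> l < h"
  shows "\<exists>r. r \<notin> A \<and> (\<forall>l\<in>L. l < r) \<and> (\<forall>h\<in>H. r < h)"
proof -
  define x where "x = (if L = {} then if H = {} then 0 else Min H - 1 else Max L)"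
  define y where "y = (if H = {} then x + 1 else Min H)"
  have "x < y"
  proof (cases "H = {}")
    case False
    then have "Min H \<in> H" using assms(2) by simp
    then show ?thesis using assms(1,4) False by (cases "L = {}") (simp_all add: x_def y_def)
  qed (simp add: y_def)
  then have "infinite {x<..<y}" by simp
  then obtain r where r: "r \<in> {x<..<y} - A"
    using assms(3) by (metis Diff_infinite_finite equals0I infinite_imp_nonempty)
  have "l < r" if "l \<in> L" for l
  proof -
    have "l \<le> x" using that assms(1) by (auto simp: x_def)
    then show ?thesis using r by simp
  qed
  moreover have "r < h" if "h \<in> H" for h
  proof -
    have "y \<le> h" using that assms(2) by (auto simp: y_def)
    then show ?thesis using r by simp
  qed
  ultimately show ?thesis using r by blast
qed

lemma same_order_snoc:
  assumes "same_order us vs" "\<And>i. i < length us \<Longrightarrow> us ! i < r \<longleftrightarrow> vs ! i < s"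
    "r \<notin> set us" "s \<notin> set vs"
  shows "same_order (us @ [r]) (vs @ [s])"
proof -
  have len: "length us = length vs" using assms(1) by (simp add: same_order_def)
  have "r < us ! i \<longleftrightarrow> s < vs ! i" if "i < length us" for i
  proof -
    have "us ! i \<noteq> r" "vs ! i \<noteq> s" using assms(3,4) that len by auto
    then show ?thesis using assms(2)[OF that] by (metis linorder_neqE order_less_asym)
  qed
  then show ?thesis
    using assms(1,2) len by (auto simp: same_order_def nth_append less_Suc_eq)
qed

lemma same_order_extend_by_one:
  fixes us :: "real list" and A :: "real set"
  assumes "same_order us vs" "finite A" "set us \<subseteq> A" "s \<notin> set vs"
  obtains r where "r \<notin> A" "same_order (us @ [r]) (vs @ [s])"
proof -
  have len: "length us = length vs" using assms(1) by (simp add: same_order_def)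
  define L where "L = (!) us ` {i. i < length us \<and> vs ! i < s}"
  define H where "H = (!) us ` {i. i < length us \<and> s < vs ! i}"
  have less: "l < h" if "l \<in> L" "h \<in> H" for l h
    using that assms(1) by (auto simp: L_def H_def same_order_def)
  have "finite L" "finite H" by (simp_all add: L_def H_def)
  from real_cut_avoiding[OF this assms(2) less]
  obtain r where r: "r \<notin> A" "\<forall>l\<in>L. l < r" "\<forall>h\<in>H. r < h" by blast
  have "us ! i < r \<longleftrightarrow> vs ! i < s" if i: "i < length us" for i
  proof -
    have "vs ! i \<noteq> s" using assms(4) i len by auto
    then consider "vs ! i < s" | "s < vs ! i" by fastforce
    then show ?thesis
    proof cases
      case 1
      then show ?thesis using r(2) i by (auto simp: L_def)
    next
      case 2
      then have "r < us ! i" using r(3) i by (auto simp: H_def)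
      then show ?thesis using 2 by auto
    qed
  qed
  then have "same_order (us @ [r]) (vs @ [s])"
    using assms r(1) by (intro same_order_snoc) auto
  then show thesis using that r(1) by blast
qed

text \<open>
  The new entries are inserted one by one. The set \<open>A\<close> contains all the values that are already used,
  including those that lie outside the part \<open>us\<close> that is compared with \<open>vs\<close>.
\<close>

lemma same_order_extend:
  fixes us :: "real list" and A :: "real set"
  assumes "same_order us vs" "finite A" "set us \<subseteq> A" "distinct (vs @ ws)"
  obtains zs where "distinct zs" "set zs \<inter> A = {}" "same_order (us @ zs) (vs @ ws)"
  using assms
proof (induction ws arbitrary: us vs A thesis)
  case Nil
  then show ?case by (metis append_Nil2 distinct.simps(1) empty_set inf_bot_left)
next
  case (Cons s ws)
  have "s \<notin> set vs" using Cons.prems(5) by simp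
  then obtain r where r: "r \<notin> A" "same_order (us @ [r]) (vs @ [s])"
    using same_order_extend_by_one[OF Cons.prems(2-4)] by blast
  have "finite (insert r A)" "set (us @ [r]) \<subseteq> insert r A" "distinct ((vs @ [s]) @ ws)"
    using Cons.prems(3-5) by auto
  then obtain zs where zs: "distinct zs" "set zs \<inter> insert r A = {}"
      "same_order ((us @ [r]) @ zs) ((vs @ [s]) @ ws)"
    using Cons.IH[OF _ r(2)] by blast
  then show ?case using Cons.prems(1)[of "r # zs"] r(1) by simp
qed

text \<open>
  Only the entries in the overlap have prescribed positions relative to both \<open>x\<close> and \<open>y\<close>, and
  there the two orders agree; so the rest of \<open>y\<close> can be appended to \<open>x\<close> with values chosen to fit
  \<open>y\<close>.
\<close>

lemma amalgamate:
  assumes x: "is_permutation x" and y: "is_permutation y"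
    and k: "k \<le> length x" "k \<le> length y"
    and overlap: "perm_of (drop (length x - k) x) = perm_of (take k y)"
  obtains z where "is_permutation z" "length z = length x + length y - k"
    "factor 0 (length x) z = x" "factor (length x - k) (length y) z = y"
proof -
  have dx: "distinct x" and dy: "distinct y" using x y by (simp_all add: distinct_if_permutation)
  define xs where "xs = map real x"
  have xs: "distinct xs" "same_order x xs"
    using dx by (auto simp: xs_def distinct_map inj_on_def same_order_def)
  have "same_order (drop (length x - k) x) (take k y)"
    using overlap dx dy by (simp add: perm_of_eq_iff)
  then have "same_order (drop (length x - k) xs) (take k y)"
    using xs(2) by (meson same_order_drop same_order_sym same_order_trans)
  then obtain zs where zs: "distinct zs" "set zs \<inter> set xs = {}"
      "same_order (drop (length x - k) xs @ zs) (take k y @ drop k y)"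
  proof (rule same_order_extend)
    show "set (drop (length x - k) xs) \<subseteq> set xs" by (rule set_drop_subset)
    show "distinct (take k y @ drop k y)" using dy by simp
  qed (simp, blast)
  have d: "distinct (xs @ zs)" using xs(1) zs(1,2) by auto
  have "length (drop (length x - k) xs @ zs) = length y" using zs(3) by (simp add: same_order_def)
  then have len: "length zs = length y - k" using k by (simp add: xs_def)
  have lenx: "length xs = length x" by (simp add: xs_def)
  show thesis
  proof (rule that[of "perm_of (xs @ zs)"])
    show "is_permutation (perm_of (xs @ zs))" using d by (rule is_permutation_perm_of)
    show "length (perm_of (xs @ zs)) = length x + length y - k"
      using d len lenx k by (simp add: length_perm_of)
    show "factor 0 (length x) (perm_of (xs @ zs)) = x"
      using xs x by (simp add: factor_perm_of[OF d] lenx perm_of_unique)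
    have "take (length y) (drop (length x - k) (xs @ zs)) = drop (length x - k) xs @ zs"
      using len lenx k by simp
    moreover have "perm_of (drop (length x - k) xs @ zs) = y"
    proof (rule perm_of_unique[OF _ y])
      show "distinct (drop (length x - k) xs @ zs)"
        using d set_drop_subset[of "length x - k" xs] by auto
      show "same_order y (drop (length x - k) xs @ zs)" using zs(3) by (simp add: same_order_sym)
    qed
    ultimately show "factor (length x - k) (length y) (perm_of (xs @ zs)) = y"
      by (simp only: factor_perm_of[OF d])
  qed
qed

section \<open>Atomicity as joint embedding\<close>

definition joint_embedding :: "nat list set \<Rightarrow> bool" where
  "joint_embedding C \<longleftrightarrow> (\<forall>x\<in>C. \<forall>y\<in>C. \<exists>z\<in>C. x \<le>\<^sub>f z \<and> y \<le>\<^sub>f z)"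

text \<open>
  If \<open>x\<close> and \<open>y\<close> have no common upper bound, then \<open>C\<close> is the union of its members avoiding \<open>x\<close>
  and its members avoiding \<open>y\<close>. Conversely, a common upper bound of an element outside \<open>A\<close> and one
  outside \<open>B\<close> can be in neither of the downward closed sets \<open>A\<close> and \<open>B\<close>.
\<close>

lemma atomic_iff_joint_embedding:
  assumes "downward_closed C"
  shows "atomic C \<longleftrightarrow> joint_embedding C"
proof
  assume atomic: "atomic C"
  have perm: "is_permutation z" if "z \<in> C" for z
    using assms that by (auto simp: downward_closed_def)
  define av where "av x = {z \<in> C. \<not> x \<le>\<^sub>f z}" for x
  have closed: "downward_closed (av x)" for x
    using assms perm contiguous_le_trans
    unfolding downward_closed_def av_def by blast
  have proper: "av x \<subset> C" if "x \<in> C" for x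
    using that contiguous_le_refl[OF perm] by (auto simp: av_def)
  show "joint_embedding C"
    unfolding joint_embedding_def
  proof (intro ballI, rule ccontr)
    fix x y assume "x \<in> C" "y \<in> C" and no: "\<not> (\<exists>z\<in>C. x \<le>\<^sub>f z \<and> y \<le>\<^sub>f z)"
    from no have cover: "C = av x \<union> av y" by (auto simp: av_def)
    have "\<exists>A B. downward_closed A \<and> downward_closed B \<and> A \<subset> C \<and> B \<subset> C \<and> C = A \<union> B"
      by (intro exI[of _ "av x"] exI[of _ "av y"] conjI closed proper \<open>x \<in> C\<close> \<open>y \<in> C\<close> cover)
    then show False using atomic unfolding atomic_def by contradiction
  qed
next
  assume joint: "joint_embedding C"
  show "atomic C"
    unfolding atomic_def
  proof (intro notI, elim exE conjE)
    fix A B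
    assume AB: "downward_closed A" "downward_closed B" "A \<subset> C" "B \<subset> C" "C = A \<union> B"
    from AB(3,4) obtain x y where xy: "x \<in> C" "x \<notin> A" "y \<in> C" "y \<notin> B" by blast
    then obtain z where z: "z \<in> C" "x \<le>\<^sub>f z" "y \<le>\<^sub>f z" using joint by (auto simp: joint_embedding_def)
    have "is_permutation x" "is_permutation y" using assms xy by (auto simp: downward_closed_def)
    then have "z \<notin> A" "z \<notin> B" using AB(1,2) xy z(2,3) by (auto simp: downward_closed_def)
    then show False using z(1) AB(5) by blast
  qed
qed

section \<open>Walks in digraphs\<close>

abbreviation walk :: "'a rel \<Rightarrow> 'a list \<Rightarrow> bool" where
  "walk E \<equiv> successively (\<lambda>u v. (u, v) \<in> E)"

definition walks :: "'a set \<Rightarrow> 'a rel \<Rightarrow> 'a list set" where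
  "walks V E = {w. w \<noteq> [] \<and> set w \<subseteq> V \<and> walk E w}"

lemma in_vwalk_arcs_iff: "(u, v) \<in> set (vwalk_arcs w) \<longleftrightarrow> (\<exists>a c. w = a @ u # v # c)"
proof (induction w rule: vwalk_arcs.induct)
  case (3 x y xs)
  have "(\<exists>a c. x # y # xs = a @ u # v # c) \<longleftrightarrow>
      x = u \<and> y = v \<or> (\<exists>a c. y # xs = a @ u # v # c)"
    by (auto simp: Cons_eq_append_conv)
  then show ?case using 3 by auto
qed auto

lemma walk_iff_arcs: "walk E w \<longleftrightarrow> set (vwalk_arcs w) \<subseteq> E"
  by (induction w rule: vwalk_arcs.induct) auto

lemma vwalk_iff_walks: "vwalk w (with_proj G) \<longleftrightarrow> w \<in> walks (pverts G) (parcs G)"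
  by (auto simp: vwalk_def walks_def walk_iff_arcs)

lemma set_subset_if_walk:
  assumes "E \<subseteq> V \<times> V" "walk E w" "2 \<le> length w"
  shows "set w \<subseteq> V"
  using assms(2,3)
proof (induction w rule: vwalk_arcs.induct)
  case (3 x y xs)
  then show ?case using assms(1) by (cases xs) auto
qed auto

lemma walk_extend_in_walks:
  assumes "E \<subseteq> V \<times> V" "w \<in> walks V E" "walk E (a @ w @ c)"
  shows "a @ w @ c \<in> walks V E"
proof (cases "a = [] \<and> c = []")
  case False
  then have "2 \<le> length (a @ w @ c)"
    using assms(2) by (cases w; cases a; cases c) (auto simp: walks_def)
  then have "set (a @ w @ c) \<subseteq> V" by (rule set_subset_if_walk[OF assms(1,3)])
  then show ?thesis using assms(2,3) by (simp add: walks_def)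
qed (use assms in auto)

lemma walk_rtrancl: "walk E (u # w) \<Longrightarrow> v \<in> set (u # w) \<Longrightarrow> (u, v) \<in> E\<^sup>*"
  by (induction w arbitrary: u) (auto intro: converse_rtrancl_into_rtrancl)

lemma walk_rtrancl_last:
  assumes "walk E w" "v \<in> set w"
  shows "(v, last w) \<in> E\<^sup>*"
proof -
  obtain a c where w: "w = a @ v # c" using assms(2) by (metis split_list)
  then have "walk E (v # c)" using assms(1) by (simp add: successively_append_iff)
  then show ?thesis using walk_rtrancl[of E v c "last w"] w by simp
qed

lemma rtrancl_walk:
  assumes "(u, v) \<in> E\<^sup>*"
  obtains w where "walk E (u # w)" "last (u # w) = v"
  using assms
proof (induction arbitrary: thesis rule: converse_rtrancl_induct)
  case base
  then show ?case by (metis last_ConsL successively.simps(2))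
next
  case (step y z)
  then show ?case by (metis last_ConsR list.simps(3) successively.simps(3))
qed

text \<open>
  Between two passages of the arc \<open>(s, t)\<close> a walk would return from \<open>t\<close> to \<open>s\<close>.
\<close>

lemma bridge_once:
  assumes "walk E (a @ s # t # c)" "a @ s # t # c = a' @ s # t # c'" "(t, s) \<notin> E\<^sup>*"
  shows "a = a'"
proof -
  have *: "us = []" if "walk E (s # t # c)" "s # t # c = us @ s # t # c'" for us c c'
  proof (rule ccontr)
    assume "us \<noteq> []"
    then have "s \<in> set (t # c)" using that(2) by (auto simp: Cons_eq_append_conv)
    then show False using that(1) walk_rtrancl[of E t c s] assms(3) by simp
  qed
  from assms(2) obtain us where
    "a = a' @ us \<and> us @ s # t # c = s # t # c' \<or> a @ us = a' \<and> s # t # c = us @ s # t # c'"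
    unfolding append_eq_append_conv2 by blast
  then show ?thesis
  proof (elim disjE conjE)
    assume us: "a = a' @ us" "us @ s # t # c = s # t # c'"
    have "walk E (s # t # c')" using assms(1,2) by (simp add: successively_append_iff)
    then have "us = []" by (rule *) (rule us(2)[symmetric])
    then show ?thesis using us(1) by simp
  next
    assume us: "a @ us = a'" "s # t # c = us @ s # t # c'"
    have "walk E (s # t # c)" using assms(1) by (simp add: successively_append_iff)
    then have "us = []" by (rule *) (rule us(2))
    then show ?thesis using us(1) by simp
  qed
qed

lemma walk_nth_rtrancl:
  assumes "walk E w" "i \<le> j" "j < length w"
  shows "(w ! i, w ! j) \<in> E\<^sup>*"
proof -
  have w: "take i w @ w ! i # drop (Suc i) w = w" using assms by (simp add: Cons_nth_drop_Suc)
  then have "walk E (w ! i # drop (Suc i) w)"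
    using assms(1) successively_append_iff[of _ "take i w" "w ! i # drop (Suc i) w"] by simp
  moreover have "w ! j \<in> set (w ! i # drop (Suc i) w)"
    using assms nth_mem[of "j - i" "drop i w"] by (simp add: Cons_nth_drop_Suc)
  ultimately show ?thesis by (rule walk_rtrancl)
qed

lemma sublist_singleD:
  assumes "sublist [v] w"
  obtains i where "i < length w" "w ! i = v"
  using set_mono_sublist[OF assms] by (auto simp: in_set_conv_nth)

lemma sublist_pairD:
  assumes "sublist [u, v] w"
  obtains i where "Suc i < length w" "w ! i = u" "w ! Suc i = v"
proof -
  obtain a c where "w = a @ [u, v] @ c" using assms by (auto simp: sublist_def)
  then show thesis by (intro that[of "length a"]) (simp_all add: nth_append)
qed

section \<open>Common walks and bridging arcs\<close>

definition joint_walks :: "'a set \<Rightarrow> 'a rel \<Rightarrow> bool" where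
  "joint_walks V E \<longleftrightarrow>
     (\<forall>w\<^sub>1\<in>walks V E. \<forall>w\<^sub>2\<in>walks V E. \<exists>w\<in>walks V E. sublist w\<^sub>1 w \<and> sublist w\<^sub>2 w)"

text \<open>
  The arc \<open>(s, t)\<close> is the only link between the part of the graph that leads to \<open>s\<close> and the part
  that is reached from \<open>t\<close>; the former is deterministic backwards and the latter is deterministic
  forwards.
\<close>

definition thin_bridge :: "'a set \<Rightarrow> 'a rel \<Rightarrow> 'a \<Rightarrow> 'a \<Rightarrow> bool" where
  "thin_bridge V E s t \<longleftrightarrow> (s, t) \<in> E \<and> (t, s) \<notin> E\<^sup>* \<and>
     (\<forall>v\<in>V. (v, s) \<in> E\<^sup>* \<or> (t, v) \<in> E\<^sup>*) \<and>
     (\<forall>u v. (u, v) \<in> E \<longrightarrow> (v, s) \<in> E\<^sup>* \<or> u = s \<and> v = t \<or> (t, u) \<in> E\<^sup>*) \<and>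
     (\<forall>u u' v. (u, v) \<in> E \<and> (u', v) \<in> E \<and> (v, s) \<in> E\<^sup>* \<longrightarrow> u = u') \<and>
     (\<forall>u v v'. (u, v) \<in> E \<and> (u, v') \<in> E \<and> (t, u) \<in> E\<^sup>* \<longrightarrow> v = v')"

lemma joint_walksE:
  assumes "joint_walks V E" "w\<^sub>1 \<in> walks V E" "w\<^sub>2 \<in> walks V E"
  obtains w where "w \<in> walks V E" "walk E w" "sublist w\<^sub>1 w" "sublist w\<^sub>2 w"
  using assms unfolding joint_walks_def walks_def by blast

text \<open>
  A common walk of \<open>u\<close> and \<open>v\<close> leads from \<open>v\<close> to \<open>u\<close>. Some arc \<open>(s, t)\<close> on the way
  has no way back, for otherwise one could return to \<open>v\<close> arc by arc. A common walk of \<open>(s, t)\<close> and another vertex or arc puts the latter before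
  or after \<open>(s, t)\<close>. Two arcs into a vertex leading to \<open>s\<close> start two walks that are equal up to
  \<open>t\<close> except for their first vertex; in a common walk both pass \<open>(s, t)\<close> at the same place, so the
  first vertices agree too. The argument for two arcs out of a vertex reached from \<open>t\<close> is symmetric.
\<close>

lemma joint_walks_imp_thin_bridge:
  assumes E: "E \<subseteq> V \<times> V" and J: "joint_walks V E"
    and uv: "u \<in> V" "v \<in> V" "(u, v) \<notin> E\<^sup>*"
  obtains s t where "thin_bridge V E s t"
proof -
  have single: "[x] \<in> walks V E" if "x \<in> V" for x using that by (simp add: walks_def)
  have arc: "[x, y] \<in> walks V E" if "(x, y) \<in> E" for x y using that E by (auto simp: walks_def)
  have "(v, u) \<in> E\<^sup>*"
  proof -
    obtain w where w: "w \<in> walks V E" "walk E w" "sublist [u] w" "sublist [v] w"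
      by (rule joint_walksE[OF J single[OF uv(1)] single[OF uv(2)]])
    then obtain i j where "i < length w" "w ! i = u" "j < length w" "w ! j = v"
      by (meson sublist_singleD)
    then show ?thesis using w(2) walk_nth_rtrancl[of E w i j] walk_nth_rtrancl[of E w j i] uv(3)
      by (cases "i \<le> j") auto
  qed
  moreover have "(u, v) \<in> E\<^sup>*" if "\<forall>s t. (s, t) \<in> E \<longrightarrow> (t, s) \<in> E\<^sup>*" "(v, u) \<in> E\<^sup>*"
    using that(2) by induction (use that(1) in \<open>auto intro: rtrancl_trans\<close>)
  ultimately obtain s t where st: "(s, t) \<in> E" "(t, s) \<notin> E\<^sup>*" using uv(3) by blast
  have vert: "(x, s) \<in> E\<^sup>* \<or> (t, x) \<in> E\<^sup>*" if x: "x \<in> V" for x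
  proof -
    obtain w where w: "w \<in> walks V E" "walk E w" "sublist [x] w" "sublist [s, t] w"
      by (rule joint_walksE[OF J single[OF x] arc[OF st(1)]])
    then obtain i j where "i < length w" "w ! i = x" "Suc j < length w" "w ! j = s" "w ! Suc j = t"
      by (meson sublist_singleD sublist_pairD)
    then show ?thesis
      using w(2) walk_nth_rtrancl[of E w i j] walk_nth_rtrancl[of E w "Suc j" i]
      by (cases "i \<le> j") auto
  qed
  have arcs: "(y, s) \<in> E\<^sup>* \<or> x = s \<and> y = t \<or> (t, x) \<in> E\<^sup>*" if xy: "(x, y) \<in> E" for x y
  proof -
    obtain w where w: "w \<in> walks V E" "walk E w" "sublist [x, y] w" "sublist [s, t] w"
      by (rule joint_walksE[OF J arc[OF xy] arc[OF st(1)]])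
    then obtain i j where ij: "Suc i < length w" "w ! i = x" "w ! Suc i = y"
        "Suc j < length w" "w ! j = s" "w ! Suc j = t"
      by (meson sublist_singleD sublist_pairD)
    then show ?thesis
      using w(2) walk_nth_rtrancl[of E w "Suc i" j] walk_nth_rtrancl[of E w "Suc j" i]
      by (cases i j rule: linorder_cases) auto
  qed
  have pred: "x = x'" if *: "(x, y) \<in> E" "(x', y) \<in> E" "(y, s) \<in> E\<^sup>*" for x x' y
  proof -
    obtain m where m: "walk E (y # m)" "last (y # m) = s" using *(3) by (rule rtrancl_walk)
    define m' where "m' = butlast (y # m)"
    have ym: "y # m = m' @ [s]" unfolding m'_def using m(2) by (metis append_butlast_last_id list.discI)
    have zw: "z # m' @ [s, t] \<in> walks V E" if "(z, y) \<in> E" for z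
    proof -
      have "walk E ((y # m) @ [t])"
        using m st(1) unfolding successively_append_iff[of _ "y # m"] by simp
      then have "walk E (z # y # m @ [t])" using that by simp
      then have "walk E (z # m' @ [s, t])" using ym by (metis append.assoc append_Cons append_Nil)
      then show ?thesis using set_subset_if_walk[OF E, of "z # m' @ [s, t]"] by (auto simp: walks_def)
    qed
    obtain w where w: "w \<in> walks V E" "walk E w" "sublist (x # m' @ [s, t]) w" "sublist (x' # m' @ [s, t]) w"
      by (rule joint_walksE[OF J zw[OF *(1)] zw[OF *(2)]])
    obtain a c a' c' where ac: "w = a @ (x # m' @ [s, t]) @ c" "w = a' @ (x' # m' @ [s, t]) @ c'"
      using w(3,4) unfolding sublist_def by blast
    then have "(a @ x # m') @ s # t # c = (a' @ x' # m') @ s # t # c'" by simp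
    moreover have "walk E ((a @ x # m') @ s # t # c)" using w(2) ac(1) by simp
    ultimately have "a @ x # m' = a' @ x' # m'" using bridge_once st(2) by metis
    then show ?thesis by (metis append_eq_append_conv length_Cons list.inject)
  qed
  have succ: "y = y'" if *: "(x, y) \<in> E" "(x, y') \<in> E" "(t, x) \<in> E\<^sup>*" for x y y'
  proof -
    obtain m where m: "walk E (t # m)" "last (t # m) = x" using *(3) by (rule rtrancl_walk)
    have zw: "s # t # m @ [z] \<in> walks V E" if "(x, z) \<in> E" for z
    proof -
      have "walk E ((t # m) @ [z])"
        using m that unfolding successively_append_iff[of _ "t # m"] by simp
      then have "walk E (s # t # m @ [z])" using st(1) by simp
      then show ?thesis using set_subset_if_walk[OF E, of "s # t # m @ [z]"] by (auto simp: walks_def)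
    qed
    obtain w where w: "w \<in> walks V E" "walk E w" "sublist (s # t # m @ [y]) w" "sublist (s # t # m @ [y']) w"
      by (rule joint_walksE[OF J zw[OF *(1)] zw[OF *(2)]])
    obtain a c a' c' where ac: "w = a @ (s # t # m @ [y]) @ c" "w = a' @ (s # t # m @ [y']) @ c'"
      using w(3,4) unfolding sublist_def by blast
    then have "a @ s # t # m @ y # c = a' @ s # t # m @ y' # c'" by simp
    moreover have "walk E (a @ s # t # m @ y # c)" using w(2) ac(1) by simp
    ultimately have "a = a'" using bridge_once st(2) by metis
    then show ?thesis using ac by simp
  qed
  show thesis using that[of s t] st vert arcs pred succ unfolding thin_bridge_def by blast
qed

text \<open>
  Backwards from \<open>s\<close> there is only one way to go.
\<close>

lemma suffix_comparable:
  assumes "walk E (a @ [s])" "walk E (a' @ [s])" "length a \<le> length a'"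
    and pred: "\<forall>u u' v. (u, v) \<in> E \<and> (u', v) \<in> E \<and> (v, s) \<in> E\<^sup>* \<longrightarrow> u = u'"
  shows "suffix a a'"
  using assms(1,3)
proof (induction a)
  case (Cons x a)
  then obtain d where d: "a' = d @ a" by (auto simp: successively_Cons suffix_def)
  with Cons.prems(2) have "d \<noteq> []" by auto
  then obtain d' y where d': "d = d' @ [y]" by (metis rev_exhaust)
  obtain z r where z: "a @ [s] = z # r" by (cases a) auto
  have "walk E (y # a @ [s])" using assms(2) d d' by (simp add: successively_append_iff)
  then have "(x, z) \<in> E" "(y, z) \<in> E" "walk E (z # r)" using Cons.prems(1) z by auto
  moreover have "s = last (z # r)" using z by (metis last_snoc)
  ultimately have "x = y" using pred walk_rtrancl[of E z r s] last_in_set by blast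
  then show ?case using d d' by (simp add: suffix_def)
qed simp

lemma walk_rev: "walk E (rev w) \<longleftrightarrow> walk (E\<inverse>) w"
  by simp

text \<open>
  This is the dual of \<open>suffix_comparable\<close>, obtained by reversing all arcs.
\<close>

lemma prefix_comparable:
  assumes "walk E (t # c)" "walk E (t # c')" "length c \<le> length c'"
    and succ: "\<forall>u v v'. (u, v) \<in> E \<and> (u, v') \<in> E \<and> (t, u) \<in> E\<^sup>* \<longrightarrow> v = v'"
  shows "prefix c c'"
proof -
  have "suffix (rev c) (rev c')"
  proof (rule suffix_comparable[where E = "E\<inverse>" and s = t])
    show "walk (E\<inverse>) (rev c @ [t])" "walk (E\<inverse>) (rev c' @ [t])"
      using assms(1,2) walk_rev[of "E\<inverse>" "t # c"] walk_rev[of "E\<inverse>" "t # c'"] by simp_all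
  qed (use assms(3) succ in \<open>auto simp: rtrancl_converse\<close>)
  then show ?thesis by (simp add: suffix_to_prefix)
qed

text \<open>
  A walk that stays on the side of \<open>s\<close> can be prolonged to the bridge, a walk that stays on the side
  of \<open>t\<close> can be started before it, and any other walk has to cross it.
\<close>

lemma thin_bridge_walk_extends:
  assumes T: "thin_bridge V E s t" and "w \<in> walks V E"
  obtains a c where "walk E (a @ s # t # c)" "sublist w (a @ s # t # c)"
proof -
  have st: "(s, t) \<in> E" using T by (simp add: thin_bridge_def)
  have w: "w \<noteq> []" "set w \<subseteq> V" "walk E w" using assms(2) by (auto simp: walks_def)
  have vert: "(v, s) \<in> E\<^sup>* \<or> (t, v) \<in> E\<^sup>*" if "v \<in> V" for v
    using T that unfolding thin_bridge_def by blast
  consider (before) "(last w, s) \<in> E\<^sup>*" | (after) "(t, hd w) \<in> E\<^sup>*"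
    | (across) "(hd w, s) \<in> E\<^sup>*" "(last w, s) \<notin> E\<^sup>*"
    using vert[OF subsetD[OF w(2) hd_in_set[OF w(1)]]] by blast
  then show thesis
  proof cases
    case before
    then obtain m where m: "walk E (last w # m)" "last (last w # m) = s" by (rule rtrancl_walk)
    define z where "z = w @ m"
    have z: "walk E z" "z \<noteq> []" "last z = s"
      using m w by (auto simp: z_def successively_append_iff successively_Cons split: if_splits)
    then have zb: "butlast z @ [s] = z" by (metis append_butlast_last_id)
    then have zt: "butlast z @ s # t # [] = z @ [t]" by (metis append.assoc append_Cons append_Nil)
    then have eq: "butlast z @ s # t # [] = w @ m @ [t]" by (simp add: z_def)
    have "walk E (z @ [t])" using z st by (auto simp: successively_append_iff)
    then have "walk E (butlast z @ s # t # [])" unfolding zt .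

    then show thesis using that[of "butlast z" "[]"] eq by (metis sublist_append_rightI)
  next
    case after
    then obtain m where m: "walk E (t # m)" "last (t # m) = hd w" by (rule rtrancl_walk)
    obtain x w' where x: "w = x # w'" using w(1) by (cases w) auto
    define z where "z = butlast (t # m)"
    have tm: "t # m = z @ [x]" using m(2) x unfolding z_def
      by (metis append_butlast_last_id list.discI list.sel(1))
    then have eq: "s # t # m @ w' = s # z @ w" using x by simp
    have "walk E (x # w')" using w(3) x by simp
    then have "walk E ((z @ [x]) @ w')"
      using m(1) tm by (simp add: successively_append_iff successively_Cons)
    then have "walk E ((t # m) @ w')" using tm by simp
    then have "walk E (s # t # m @ w')" using st by simp
    then show thesis using that[of "[]" "m @ w'"] eq
      by (metis append_Cons append_Nil sublist_append_leftI)
  next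
    case across
    have "\<exists>a u v c. w = a @ u # v # c \<and> (u, s) \<in> E\<^sup>* \<and> (v, s) \<notin> E\<^sup>*"
      using w(1) across
    proof (induction w)
      case (Cons x w)
      show ?case
      proof (cases "(hd w, s) \<in> E\<^sup>*")
        case True
        then have "w \<noteq> []" using Cons.prems by (cases w) auto
        then have "\<exists>a u v c. w = a @ u # v # c \<and> (u, s) \<in> E\<^sup>* \<and> (v, s) \<notin> E\<^sup>*"
          using Cons True by auto
        then show ?thesis by (metis append_Cons)
      next
        case False
        moreover have "w \<noteq> []" using Cons.prems by (cases w) auto
        ultimately have "x # w = [] @ x # hd w # tl w \<and> (x, s) \<in> E\<^sup>* \<and> (hd w, s) \<notin> E\<^sup>*"
          using Cons.prems by simp
        then show ?thesis by blast
      qed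
    qed simp
    then obtain a u v c where a: "w = a @ u # v # c" "(u, s) \<in> E\<^sup>*" "(v, s) \<notin> E\<^sup>*" by blast
    then have "(u, v) \<in> E" using w(3) by (simp add: successively_append_iff)
    then have "u = s \<and> v = t \<or> (t, u) \<in> E\<^sup>*" using T a(3) by (auto simp: thin_bridge_def)
    moreover have "(t, u) \<notin> E\<^sup>*"
      using T a(2) by (auto simp: thin_bridge_def dest: rtrancl_trans)
    ultimately show thesis using that[of a c] w(3) a(1) by auto
  qed
qed

text \<open>
  Two walks through \<open>(s, t)\<close> are aligned along this arc: of their parts before it one is a
  suffix of the other, of their parts after it one is a prefix of the other, and the two
  longer parts make up a common walk.
\<close>

lemma thin_bridge_imp_joint_walks:
  assumes E: "E \<subseteq> V \<times> V" and T: "thin_bridge V E s t"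
  shows "joint_walks V E"
  unfolding joint_walks_def
proof (intro ballI)
  fix w\<^sub>1 w\<^sub>2 assume w1: "w\<^sub>1 \<in> walks V E" and w2: "w\<^sub>2 \<in> walks V E"
  obtain a c where ac: "walk E (a @ s # t # c)" "sublist w\<^sub>1 (a @ s # t # c)"
    using thin_bridge_walk_extends[OF T w1] by blast
  obtain a' c' where ac': "walk E (a' @ s # t # c')" "sublist w\<^sub>2 (a' @ s # t # c')"
    using thin_bridge_walk_extends[OF T w2] by blast
  have W: "walk E (a @ [s])" "walk E (a' @ [s])" "walk E (t # c)" "walk E (t # c')"
    using ac(1) ac'(1) by (auto simp: successively_append_iff)
  have pred: "\<forall>u u' v. (u, v) \<in> E \<and> (u', v) \<in> E \<and> (v, s) \<in> E\<^sup>* \<longrightarrow> u = u'"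
    and succ: "\<forall>u v v'. (u, v) \<in> E \<and> (u, v') \<in> E \<and> (t, u) \<in> E\<^sup>* \<longrightarrow> v = v'"
    and st: "(s, t) \<in> E"
    using T unfolding thin_bridge_def by blast+
  have "suffix a a' \<or> suffix a' a"
    using suffix_comparable[OF W(1,2) _ pred] suffix_comparable[OF W(2,1) _ pred] nat_le_linear
    by blast
  then obtain A where A: "walk E (A @ [s])" "suffix a A" "suffix a' A"
    using W(1,2) by (meson suffix_order.refl)
  have "prefix c c' \<or> prefix c' c"
    using prefix_comparable[OF W(3,4) _ succ] prefix_comparable[OF W(4,3) _ succ] nat_le_linear
    by blast
  then obtain D where D: "walk E (t # D)" "prefix c D" "prefix c' D"
    using W(3,4) by (meson prefix_order.refl)
  have "walk E (A @ s # t # D)" using A(1) D(1) st by (auto simp: successively_append_iff)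
  then have "A @ s # t # D \<in> walks V E"
    using set_subset_if_walk[OF E, of "A @ s # t # D"] by (simp add: walks_def)
  moreover have "sublist (a @ s # t # c) (A @ s # t # D)" "sublist (a' @ s # t # c') (A @ s # t # D)"
    using A(2,3) D(2,3) unfolding suffix_def prefix_def
    by (metis append.assoc append_Cons sublist_appendI)+
  ultimately show "\<exists>w\<in>walks V E. sublist w\<^sub>1 w \<and> sublist w\<^sub>2 w"
    using ac(2) ac'(2) by (meson sublist_order.order_trans)
qed

section \<open>Bicycles\<close>

lemma set_vwalk_arcs_append:
  "set (vwalk_arcs (a @ z # c)) = set (vwalk_arcs (a @ [z])) \<union> set (vwalk_arcs (z # c))"
  by (induction a rule: vwalk_arcs.induct) (auto simp: neq_Nil_conv)

lemma set_vwalk_arcs_snoc: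
  "w \<noteq> [] \<Longrightarrow> set (vwalk_arcs (w @ [z])) = insert (last w, z) (set (vwalk_arcs w))"
  by (simp add: vwalk_arcs_append)

lemma set_vwalk_arcs_rev: "set (vwalk_arcs (rev w)) = (set (vwalk_arcs w))\<inverse>"
proof (induction w)
  case (Cons x w)
  then show ?case by (cases "w = []") (auto simp: set_vwalk_arcs_snoc last_rev)
qed simp

lemma in_vwalk_arcs_nth:
  "(u, v) \<in> set (vwalk_arcs w) \<longleftrightarrow> (\<exists>i. Suc i < length w \<and> w ! i = u \<and> w ! Suc i = v)"
proof (induction w rule: vwalk_arcs.induct)
  case (3 x y xs)
  show ?case
  proof
    assume "(u, v) \<in> set (vwalk_arcs (x # y # xs))"
    then consider "u = x" "v = y" | "(u, v) \<in> set (vwalk_arcs (y # xs))" by auto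
    then show "\<exists>i. Suc i < length (x # y # xs) \<and> (x # y # xs) ! i = u \<and> (x # y # xs) ! Suc i = v"
    proof cases
      case 1
      then show ?thesis by (intro exI[of _ 0]) simp
    next
      case 2
      then obtain i where "Suc i < length (y # xs)" "(y # xs) ! i = u" "(y # xs) ! Suc i = v"
        using 3 by blast
      then show ?thesis by (intro exI[of _ "Suc i"]) simp
    qed
  next
    assume "\<exists>i. Suc i < length (x # y # xs) \<and> (x # y # xs) ! i = u \<and> (x # y # xs) ! Suc i = v"
    then obtain i where i: "Suc i < length (x # y # xs)" "(x # y # xs) ! i = u" "(x # y # xs) ! Suc i = v"
      by blast
    show "(u, v) \<in> set (vwalk_arcs (x # y # xs))"
    proof (cases i)
      case 0
      then show ?thesis using i by simp
    next
      case (Suc j)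
      then have "(u, v) \<in> set (vwalk_arcs (y # xs))" using 3 i by auto
      then show ?thesis by simp
    qed
  qed
qed auto

lemma vwalk_arcs_succ_unique:
  assumes "distinct (butlast w)" "(u, v) \<in> set (vwalk_arcs w)" "(u, v') \<in> set (vwalk_arcs w)"
  shows "v = v'"
proof -
  obtain i j where ij: "Suc i < length w" "w ! i = u" "w ! Suc i = v"
      "Suc j < length w" "w ! j = u" "w ! Suc j = v'"
    using assms(2,3) unfolding in_vwalk_arcs_nth by blast
  then have "butlast w ! i = butlast w ! j" "i < length (butlast w)" "j < length (butlast w)"
    by (simp_all add: nth_butlast)
  then have "i = j" using assms(1) nth_eq_iff_index_eq by blast
  then show ?thesis using ij by simp
qed

lemma vwalk_arcs_pred_unique:
  assumes "distinct (tl w)" "(u, v) \<in> set (vwalk_arcs w)" "(u', v) \<in> set (vwalk_arcs w)"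
  shows "u = u'"
proof -
  obtain i j where ij: "Suc i < length w" "w ! i = u" "w ! Suc i = v"
      "Suc j < length w" "w ! j = u'" "w ! Suc j = v"
    using assms(2,3) unfolding in_vwalk_arcs_nth by blast
  then have "tl w ! i = tl w ! j" "i < length (tl w)" "j < length (tl w)"
    by (simp_all add: nth_tl)
  then have "i = j" using assms(1) nth_eq_iff_index_eq by blast
  then show ?thesis using ij by simp
qed

lemma distinct_butlast_iff_tl:
  assumes "hd w = last w"
  shows "distinct (butlast w) \<longleftrightarrow> distinct (tl w)"
proof (cases w)
  case (Cons x m)
  show ?thesis
  proof (cases m rule: rev_cases)
    case (snoc m' y)
    then show ?thesis using assms Cons by auto
  qed (use Cons in simp)
qed simp

text \<open>
  The orbit of \<open>t\<close> under a partial function on a finite set: a longest path \<open>L\<close> from \<open>t\<close>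
  without repeated vertex visits the entire orbit. Either its last vertex has no successor, or the successor
  \<open>z\<close> is on \<open>L\<close> and splits it into the path \<open>\<tau>\<close> up to \<open>z\<close> and the cycle \<open>q\<close> from \<open>z\<close> onwards.
\<close>

lemma functional_orbit_lasso:
  assumes fin: "finite E"
    and succ: "\<forall>u v v'. (u, v) \<in> E \<and> (u, v') \<in> E \<and> (t, u) \<in> E\<^sup>* \<longrightarrow> v = v'"
  obtains \<tau> q where "\<tau> \<noteq> []" "hd \<tau> = t" "distinct \<tau>"
    "q = [] \<or> 2 \<le> length q \<and> hd q = last q \<and> distinct (butlast q) \<and> set \<tau> \<inter> set q = {last \<tau>}"
    "set \<tau> \<union> set q = {v. (t, v) \<in> E\<^sup>*}"
    "set (vwalk_arcs \<tau>) \<union> set (vwalk_arcs q) = {(u, v) \<in> E. (t, u) \<in> E\<^sup>*}"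
proof -
  define P where "P m \<longleftrightarrow> walk E (t # m) \<and> distinct (t # m)" for m
  have "finite {v. (t, v) \<in> E\<^sup>*}"
  proof (rule finite_subset)
    show "{v. (t, v) \<in> E\<^sup>*} \<subseteq> insert t (Range E)" by (auto elim: rtranclE)
  qed (simp add: fin finite_Range)
  then have "length m < Suc (card {v. (t, v) \<in> E\<^sup>*})" if "P m" for m
  proof -
    have "set (t # m) \<subseteq> {v. (t, v) \<in> E\<^sup>*}"
      using walk_rtrancl[of E t m] that by (auto simp only: P_def)
    then have "card (set (t # m)) \<le> card {v. (t, v) \<in> E\<^sup>*}"
      using \<open>finite {v. (t, v) \<in> E\<^sup>*}\<close> card_mono by blast
    moreover have "card (set (t # m)) = length (t # m)"
      using that unfolding P_def by (intro distinct_card) simp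
    ultimately show ?thesis by simp
  qed
  moreover have "P []" by (simp add: P_def)
  ultimately obtain m where m: "P m" "\<And>m'. P m' \<Longrightarrow> length m' \<le> length m"
    using ex_has_greatest_nat[of P "[]" length "Suc (card {v. (t, v) \<in> E\<^sup>*})"] by auto
  define L where "L = t # m"
  have L: "walk E L" "distinct L" "L \<noteq> []" "hd L = t"
    using m(1) by (simp_all add: P_def L_def)
  have reach: "(t, v) \<in> E\<^sup>*" if "v \<in> set L" for v
    using walk_rtrancl[of E t m v] L(1) that by (simp add: L_def)
  have next_arc: "(u, v) \<in> set (vwalk_arcs L) \<or> u = last L \<and> v \<in> set L"
    if u: "u \<in> set L" and uv: "(u, v) \<in> E" for u v
  proof -
    obtain a c where ac: "L = a @ u # c" using split_list[OF u] by blast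
    show ?thesis
    proof (cases c)
      case Nil
      have "v \<in> set L"
      proof (rule ccontr)
        assume v: "v \<notin> set L"
        have "walk E (L @ [v])" "distinct (L @ [v])"
          using L v uv ac Nil by (auto simp: successively_append_iff)
        then have "P (m @ [v])" by (simp add: P_def L_def)
        then show False using m(2) by fastforce
      qed
      then show ?thesis using ac Nil by simp
    next
      case (Cons x c')
      then have "(u, x) \<in> set (vwalk_arcs L)" using ac by (auto simp: in_vwalk_arcs_iff)
      moreover have "x = v"
        using succ uv reach[OF u] calculation L(1) unfolding walk_iff_arcs by blast
      ultimately show ?thesis by simp
    qed
  qed
  have in_L: "u \<in> set L" "v \<in> set L" if "(u, v) \<in> set (vwalk_arcs L)" for u v
    using that by (auto simp: in_vwalk_arcs_iff)
  have orbit: "set L = {v. (t, v) \<in> E\<^sup>*}"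
  proof (intro equalityI subsetI)
    fix v assume "v \<in> {v. (t, v) \<in> E\<^sup>*}"
    then have "(t, v) \<in> E\<^sup>*" by simp
    then show "v \<in> set L"
    proof induction
      case base
      then show ?case by (simp add: L_def)
    next
      case (step y z)
      then show ?case using next_arc in_L(2) by blast
    qed
  qed (use reach in blast)
  show thesis
  proof (cases "\<exists>z. (last L, z) \<in> E")
    case False
    have "set (vwalk_arcs L) = {(u, v) \<in> E. (t, u) \<in> E\<^sup>*}"
      using next_arc in_L(1) L(1) orbit False unfolding walk_iff_arcs by blast
    then show thesis using that[of L "[]"] L orbit by simp
  next
    case True
    then obtain z where z: "(last L, z) \<in> E" by blast
    have "z \<in> set L" using next_arc[OF last_in_set[OF L(3)] z] in_L(2) by blast
    then obtain A B where AB: "L = A @ z # B" using split_list by metis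
    define \<tau> q where "\<tau> = A @ [z]" and "q = (z # B) @ [z]"
    have "set (vwalk_arcs L) = set (vwalk_arcs \<tau>) \<union> set (vwalk_arcs (z # B))"
      unfolding AB \<tau>_def by (rule set_vwalk_arcs_append)
    moreover have "set (vwalk_arcs q) = insert (last L, z) (set (vwalk_arcs (z # B)))"
      unfolding q_def AB by (subst set_vwalk_arcs_snoc) simp_all
    ultimately have "set (vwalk_arcs \<tau>) \<union> set (vwalk_arcs q) = insert (last L, z) (set (vwalk_arcs L))"
      by blast
    also have "\<dots> = {(u, v) \<in> E. (t, u) \<in> E\<^sup>*}"
    proof (intro equalityI subsetI)
      fix e assume "e \<in> insert (last L, z) (set (vwalk_arcs L))"
      then show "e \<in> {(u, v) \<in> E. (t, u) \<in> E\<^sup>*}"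
        using z reach last_in_set[OF L(3)] in_L(1) L(1) unfolding walk_iff_arcs by (cases e) blast
    next
      fix e assume "e \<in> {(u, v) \<in> E. (t, u) \<in> E\<^sup>*}"
      then obtain u v where e: "e = (u, v)" "(u, v) \<in> E" "(t, u) \<in> E\<^sup>*" by blast
      then have "u \<in> set L" using orbit by blast
      from next_arc[OF this e(2)] show "e \<in> insert (last L, z) (set (vwalk_arcs L))"
        using succ z e by blast
    qed
    finally have arcs: "set (vwalk_arcs \<tau>) \<union> set (vwalk_arcs q) = {(u, v) \<in> E. (t, u) \<in> E\<^sup>*}" .
    have "hd \<tau> = t" using L(4) AB unfolding \<tau>_def by (cases A) simp_all
    moreover have "distinct \<tau>" using L(2) by (simp add: \<tau>_def AB)
    moreover have "2 \<le> length q \<and> hd q = last q \<and> distinct (butlast q) \<and> set \<tau> \<inter> set q = {last \<tau>}"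
      using L(2) by (auto simp: q_def \<tau>_def AB butlast_append)
    moreover have "set \<tau> \<union> set q = {v. (t, v) \<in> E\<^sup>*}"
      unfolding orbit[symmetric] by (auto simp: AB \<tau>_def q_def)
    ultimately show thesis using that[of \<tau> q] arcs by (simp add: \<tau>_def)
  qed
qed

text \<open>
  The connecting path and the terminal cycle are the forward orbit of \<open>t\<close>, the initial cycle and the
  beginning of the connecting path are the backward orbit of \<open>s\<close>, which is the orbit in the
  reversed graph read backwards.
\<close>

lemma thin_bridge_imp_bicycle:
  fixes G :: "'a pair_pre_digraph"
  defines "V \<equiv> pverts G" and "E \<equiv> parcs G"
  assumes E: "E \<subseteq> V \<times> V" and fin: "finite V" and T: "thin_bridge V E s t"
  shows "bicycle G"
proof -
  have finE: "finite E" using E fin by (meson finite_SigmaI finite_subset)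
  have st: "(s, t) \<in> E" "(t, s) \<notin> E\<^sup>*"
    and vert: "\<forall>v\<in>V. (v, s) \<in> E\<^sup>* \<or> (t, v) \<in> E\<^sup>*"
    and arcs: "\<forall>u v. (u, v) \<in> E \<longrightarrow> (v, s) \<in> E\<^sup>* \<or> u = s \<and> v = t \<or> (t, u) \<in> E\<^sup>*"
    and pred: "\<forall>u u' v. (u, v) \<in> E \<and> (u', v) \<in> E \<and> (v, s) \<in> E\<^sup>* \<longrightarrow> u = u'"
    and succ: "\<forall>u v v'. (u, v) \<in> E \<and> (u, v') \<in> E \<and> (t, u) \<in> E\<^sup>* \<longrightarrow> v = v'"
    using T unfolding thin_bridge_def by blast+
  obtain \<tau>\<^sub>2 q where q: "\<tau>\<^sub>2 \<noteq> []" "hd \<tau>\<^sub>2 = t" "distinct \<tau>\<^sub>2"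
    "q = [] \<or> 2 \<le> length q \<and> hd q = last q \<and> distinct (butlast q) \<and> set \<tau>\<^sub>2 \<inter> set q = {last \<tau>\<^sub>2}"
    "set \<tau>\<^sub>2 \<union> set q = {v. (t, v) \<in> E\<^sup>*}"
    "set (vwalk_arcs \<tau>\<^sub>2) \<union> set (vwalk_arcs q) = {(u, v) \<in> E. (t, u) \<in> E\<^sup>*}"
    by (rule functional_orbit_lasso[OF finE succ])
  have "finite (E\<inverse>)" using finE by simp
  moreover have "\<forall>u v v'. (u, v) \<in> E\<inverse> \<and> (u, v') \<in> E\<inverse> \<and> (s, u) \<in> (E\<inverse>)\<^sup>* \<longrightarrow> v = v'"
    using pred unfolding rtrancl_converse by blast
  ultimately obtain \<sigma> r where r: "\<sigma> \<noteq> []" "hd \<sigma> = s" "distinct \<sigma>"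
    "r = [] \<or> 2 \<le> length r \<and> hd r = last r \<and> distinct (butlast r) \<and> set \<sigma> \<inter> set r = {last \<sigma>}"
    "set \<sigma> \<union> set r = {v. (s, v) \<in> (E\<inverse>)\<^sup>*}"
    "set (vwalk_arcs \<sigma>) \<union> set (vwalk_arcs r) = {(u, v) \<in> E\<inverse>. (s, u) \<in> (E\<inverse>)\<^sup>*}"
    by (rule functional_orbit_lasso)
  define p \<tau>\<^sub>1 where "p = rev r" and "\<tau>\<^sub>1 = rev \<sigma>"
  have p: "\<tau>\<^sub>1 \<noteq> []" "last \<tau>\<^sub>1 = s" "distinct \<tau>\<^sub>1"
    "p = [] \<or> 2 \<le> length p \<and> hd p = last p \<and> distinct (butlast p) \<and> set \<tau>\<^sub>1 \<inter> set p = {hd \<tau>\<^sub>1}"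
    "set \<tau>\<^sub>1 \<union> set p = {v. (v, s) \<in> E\<^sup>*}"
    using r(1-5) distinct_butlast_iff_tl[of r]
    by (auto simp: p_def \<tau>\<^sub>1_def last_rev hd_rev butlast_rev rtrancl_converse)
  have p_arcs: "set (vwalk_arcs \<tau>\<^sub>1) \<union> set (vwalk_arcs p) = {(u, v) \<in> E. (v, s) \<in> E\<^sup>*}"
  proof -
    have "set (vwalk_arcs \<tau>\<^sub>1) \<union> set (vwalk_arcs p) = (set (vwalk_arcs \<sigma>) \<union> set (vwalk_arcs r))\<inverse>"
      by (simp add: p_def \<tau>\<^sub>1_def set_vwalk_arcs_rev converse_Un)
    then show ?thesis unfolding r(6) by (auto simp: rtrancl_converse)
  qed
  have disj: "(set \<tau>\<^sub>1 \<union> set p) \<inter> (set \<tau>\<^sub>2 \<union> set q) = {}"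
    unfolding p(5) q(5) using st(2) by (auto dest: rtrancl_trans)
  have inV: "v \<in> V" if "(v, s) \<in> E\<^sup>* \<or> (t, v) \<in> E\<^sup>*" for v
    using that st(1) E by (auto elim: converse_rtranclE rtranclE)
  have V: "V = set p \<union> set (\<tau>\<^sub>1 @ \<tau>\<^sub>2) \<union> set q" using inV vert p(5) q(5) by auto
  have arcs_\<tau>: "set (vwalk_arcs (\<tau>\<^sub>1 @ \<tau>\<^sub>2)) = set (vwalk_arcs \<tau>\<^sub>1) \<union> {(s, t)} \<union> set (vwalk_arcs \<tau>\<^sub>2)"
    using p(1,2) q(1,2) by (auto simp: vwalk_arcs_append)
  have E_eq: "E = set (vwalk_arcs p) \<union> set (vwalk_arcs (\<tau>\<^sub>1 @ \<tau>\<^sub>2)) \<union> set (vwalk_arcs q)"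
  proof -
    have "set (vwalk_arcs p) \<union> set (vwalk_arcs (\<tau>\<^sub>1 @ \<tau>\<^sub>2)) \<union> set (vwalk_arcs q) =
        (set (vwalk_arcs \<tau>\<^sub>1) \<union> set (vwalk_arcs p)) \<union> {(s, t)} \<union>
        (set (vwalk_arcs \<tau>\<^sub>2) \<union> set (vwalk_arcs q))"
      unfolding arcs_\<tau> by blast
    also have "\<dots> = E" unfolding p_arcs q(6) using arcs st(1) by blast
    finally show ?thesis by (rule sym)
  qed
  have vw: "vwalk w (with_proj G)" if "w \<noteq> []" "set w \<subseteq> V" "set (vwalk_arcs w) \<subseteq> E" for w
    using that by (simp add: vwalk_def V_def E_def)
  have "p = [] \<or> simple_cycle p G \<and> set (\<tau>\<^sub>1 @ \<tau>\<^sub>2) \<inter> set p = {hd (\<tau>\<^sub>1 @ \<tau>\<^sub>2)}"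
  proof (cases "p = []")
    case False
    then have "vwalk p (with_proj G)" using V E_eq by (intro vw) auto
    moreover have "set (\<tau>\<^sub>1 @ \<tau>\<^sub>2) \<inter> set p = set \<tau>\<^sub>1 \<inter> set p" using disj by auto
    ultimately show ?thesis using False p(1,4) by (simp add: simple_cycle_def)
  qed simp
  moreover have "q = [] \<or> simple_cycle q G \<and> set (\<tau>\<^sub>1 @ \<tau>\<^sub>2) \<inter> set q = {last (\<tau>\<^sub>1 @ \<tau>\<^sub>2)}"
  proof (cases "q = []")
    case False
    then have "vwalk q (with_proj G)" using V E_eq by (intro vw) auto
    moreover have "set (\<tau>\<^sub>1 @ \<tau>\<^sub>2) \<inter> set q = set \<tau>\<^sub>2 \<inter> set q" using disj by auto
    ultimately show ?thesis using False q(1,4) by (simp add: simple_cycle_def)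
  qed simp
  moreover have "set p \<inter> set q = {}" using disj by blast
  moreover have "vpath (\<tau>\<^sub>1 @ \<tau>\<^sub>2) (with_proj G)"
  proof
    show "vwalk (\<tau>\<^sub>1 @ \<tau>\<^sub>2) (with_proj G)" using V E_eq p(1) by (intro vw) auto
    show "distinct (\<tau>\<^sub>1 @ \<tau>\<^sub>2)" using p(3) q(3) disj by auto
  qed
  ultimately show ?thesis
    using V E_eq unfolding bicycle_def V_def E_def
    by (intro exI[of _ p] exI[of _ "\<tau>\<^sub>1 @ \<tau>\<^sub>2"] exI[of _ q]) simp
qed

text \<open>
  If the connecting path is a single vertex, the two cycles cannot both be present, and the bicycle is
  one cycle or one vertex. Otherwise the first arc \<open>(s, t)\<close> of the connecting path is the bridge: it
  leaves the set \<open>X\<close> consisting of \<open>s\<close> and the initial cycle, and its other side \<open>Y\<close>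
  is closed under successors.
\<close>

lemma bicycle_imp_strong_or_thin_bridge:
  fixes G :: "'a pair_pre_digraph"
  defines "V \<equiv> pverts G" and "E \<equiv> parcs G"
  assumes "bicycle G"
  shows "(\<forall>u\<in>V. \<forall>v\<in>V. (u, v) \<in> E\<^sup>*) \<or> (\<exists>s t. thin_bridge V E s t)"
proof -
  obtain p \<tau> q where B:
    "p = [] \<or> simple_cycle p G \<and> set \<tau> \<inter> set p = {hd \<tau>}"
    "q = [] \<or> simple_cycle q G \<and> set \<tau> \<inter> set q = {last \<tau>}"
    "set p \<inter> set q = {}" "vpath \<tau> (with_proj G)"
    and V: "V = set p \<union> set \<tau> \<union> set q"
    and E: "E = set (vwalk_arcs p) \<union> set (vwalk_arcs \<tau>) \<union> set (vwalk_arcs q)"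
    using assms(3) unfolding bicycle_def V_def E_def by blast
  have cyc: "(u, v) \<in> E\<^sup>*" if "simple_cycle c G" "u \<in> set c" "v \<in> set c" for c u v
  proof -
    have c: "walk E c" "hd c = last c" "c \<noteq> []"
      using that(1) by (auto simp: simple_cycle_def vwalk_def walk_iff_arcs E_def)
    then have "(u, last c) \<in> E\<^sup>*" using walk_rtrancl_last[OF _ that(2)] by blast
    moreover have "(hd c, v) \<in> E\<^sup>*"
      using c(1,3) that(3) walk_rtrancl by (cases c) (simp_all only: list.sel)
    ultimately show ?thesis using c(2) by simp
  qed
  have cyc_dist: "distinct (butlast c)" "distinct (tl c)" if "simple_cycle c G" for c
    using that distinct_butlast_iff_tl[of c] by (auto simp: simple_cycle_def)
  have \<tau>: "\<tau> \<noteq> []" "distinct \<tau>" using B(4) by (auto simp: vpath_def vwalk_def)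
  have in_set: "u \<in> set w" "v \<in> set w" if "(u, v) \<in> set (vwalk_arcs w)" for u v :: 'a and w
    using that by (auto simp: in_vwalk_arcs_iff)
  consider (one) h where "\<tau> = [h]" | (more) s t \<tau>' where "\<tau> = s # t # \<tau>'"
    using \<tau>(1) by (metis neq_Nil_conv)
  then show ?thesis
  proof cases
    case one
    then have "p = [] \<or> q = []" using B(1-3) by auto
    then consider "p = []" "q = []" | "p \<noteq> []" "q = []" | "p = []" "q \<noteq> []" by blast
    then have "\<forall>u\<in>V. \<forall>v\<in>V. (u, v) \<in> E\<^sup>*"
    proof cases
      case 1
      then show ?thesis using V one by simp
    next
      case 2
      then have "V = set p" using V B(1) one by auto
      then show ?thesis using cyc 2 B(1) by blast
    next
      case 3
      then have "V = set q" using V B(2) one by auto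
      then show ?thesis using cyc 3 B(2) by blast
    qed
    then show ?thesis ..
  next
    case more
    define X Y where "X = insert s (set p)" and "Y = set (t # \<tau>') \<union> set q"
    define F where "F = set (vwalk_arcs (t # \<tau>')) \<union> set (vwalk_arcs q)"
    have E': "E = set (vwalk_arcs p) \<union> {(s, t)} \<union> F" unfolding E F_def more by auto
    have sq: "s \<notin> set q"
    proof
      assume "s \<in> set q"
      then have "s \<in> set \<tau> \<inter> set q" "q \<noteq> []" using more by auto
      then have "s = last (t # \<tau>')" using B(2) more by auto
      then show False using \<tau>(2) more last_in_set[of "t # \<tau>'"] by simp
    qed
    have pt: "set p \<inter> set (t # \<tau>') = {}"
    proof (cases "p = []")
      case False
      then have "set \<tau> \<inter> set p = {s}" using B(1) more by simp
      then show ?thesis using \<tau>(2) more by auto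
    qed simp
    have XY: "X \<inter> Y = {}" using B(3) \<tau>(2) more sq pt by (auto simp: X_def Y_def)
    have VXY: "V = X \<union> Y" unfolding V X_def Y_def more by auto
    have pX: "u \<in> X" "v \<in> X" if "(u, v) \<in> set (vwalk_arcs p)" for u v
      using in_set[OF that] by (simp_all add: X_def)
    have FY: "u \<in> Y" "v \<in> Y" if "(u, v) \<in> F" for u v
      using that in_set[of u v "t # \<tau>'"] in_set[of u v q] unfolding F_def Y_def by blast+
    have sX: "s \<in> X" and tY: "t \<in> Y" by (simp_all add: X_def Y_def)
    have stay: "v \<in> Y" if "(u, v) \<in> E\<^sup>*" "u \<in> Y" for u v
      using that
    proof induction
      case (step y z)
      then show ?case using E' FY(2) pX(1) XY sX by blast
    qed
    have X_iff: "(v, s) \<in> E\<^sup>* \<longleftrightarrow> v \<in> X" if "v \<in> V" for v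
    proof
      assume "(v, s) \<in> E\<^sup>*"
      then show "v \<in> X" using stay[of v s] that VXY XY sX by blast
    next
      assume "v \<in> X"
      then consider "v = s" | "v \<in> set p" by (auto simp: X_def)
      then show "(v, s) \<in> E\<^sup>*"
      proof cases
        case 2
        then have "simple_cycle p G" "set \<tau> \<inter> set p = {s}" using B(1) more by auto
        then show ?thesis using cyc 2 by blast
      qed simp
    qed
    have tq: "(t, v) \<in> E\<^sup>*" if "v \<in> Y" for v
    proof -
      have "walk E (t # \<tau>')" using E' unfolding walk_iff_arcs F_def by blast
      then have reach: "(t, w) \<in> E\<^sup>*" if "w \<in> set (t # \<tau>')" for w
        using that walk_rtrancl by metis
      show ?thesis
      proof (cases "v \<in> set q")
        case True
        then have q: "simple_cycle q G" "set \<tau> \<inter> set q = {last \<tau>}" using B(2) by auto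
        moreover have "last \<tau> \<in> set (t # \<tau>')" using more by simp
        ultimately show ?thesis using cyc[OF q(1) _ True, of "last \<tau>"] reach[of "last \<tau>"]
          by (metis IntD2 insertI1 rtrancl_trans)
      qed (use that reach in \<open>auto simp: Y_def\<close>)
    qed
    have "thin_bridge V E s t" unfolding thin_bridge_def
    proof (intro conjI allI impI ballI; (elim conjE)?)
      show "(s, t) \<in> E" by (simp add: E')
      show "(t, s) \<notin> E\<^sup>*" using stay[of t s] tY sX XY by blast
      show "(v, s) \<in> E\<^sup>* \<or> (t, v) \<in> E\<^sup>*" if "v \<in> V" for v
        using X_iff tq that VXY by blast
      show "(v, s) \<in> E\<^sup>* \<or> u = s \<and> v = t \<or> (t, u) \<in> E\<^sup>*" if "(u, v) \<in> E" for u v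
        using that X_iff VXY tq pX FY unfolding E' by blast
      show "u = u'" if e: "(u, v) \<in> E" "(u', v) \<in> E" "(v, s) \<in> E\<^sup>*" for u u' v
      proof -
        have "v \<notin> Y" using stay[OF e(3)] sX XY by blast
        then have p: "(u, v) \<in> set (vwalk_arcs p)" "(u', v) \<in> set (vwalk_arcs p)"
          using e FY tY unfolding E' by blast+
        then have "simple_cycle p G" using B(1) by auto
        then show ?thesis using vwalk_arcs_pred_unique[OF cyc_dist(2)] p by blast
      qed
      show "v = v'" if e: "(u, v) \<in> E" "(u, v') \<in> E" "(t, u) \<in> E\<^sup>*" for u v v'
      proof -
        have "u \<in> Y" using stay[OF e(3) tY] .
        then have F: "(u, v) \<in> F" "(u, v') \<in> F" using e pX sX XY unfolding E' by blast+
        show ?thesis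
        proof (cases "u \<in> set q")
          case True
          then have q: "simple_cycle q G" "set \<tau> \<inter> set q = {last \<tau>}" using B(2) by auto
          have "(u, w) \<notin> set (vwalk_arcs (t # \<tau>'))" for w
          proof
            assume "(u, w) \<in> set (vwalk_arcs (t # \<tau>'))"
            then obtain a c where ac: "t # \<tau>' = a @ u # w # c" by (auto simp: in_vwalk_arcs_iff)
            then have "u \<in> set \<tau> \<inter> set q" using more True by auto
            then have "u = last (t # \<tau>')" using q(2) more by auto
            also have "\<dots> = last (w # c)" unfolding ac by simp
            finally have "u \<in> set (w # c)" using last_in_set[of "w # c"] by simp
            moreover have "distinct (a @ u # w # c)" using \<tau>(2) more ac by simp
            ultimately show False by simp
          qed
          then show ?thesis using F vwalk_arcs_succ_unique[OF cyc_dist(1)[OF q(1)]]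
            unfolding F_def by blast
        next
          case False
          then have "(u, v) \<in> set (vwalk_arcs (t # \<tau>'))" "(u, v') \<in> set (vwalk_arcs (t # \<tau>'))"
            using F in_set(1)[of u _ q] unfolding F_def by blast+
          moreover have "distinct (butlast (t # \<tau>'))"
            using \<tau>(2) more distinct_butlast[of "t # \<tau>'"] by simp
          ultimately show ?thesis using vwalk_arcs_succ_unique by metis
        qed
      qed
    qed
    then show ?thesis by blast
  qed
qed

section \<open>The walk of windows of a permutation\<close>

text \<open>
  For a member of a downward closed class this is its walk in the factor graph; it is the path whose
  \<^const>\<open>path_perms\<close> contain the permutation, see \<open>path_perms_iff\<close>.
\<close>

definition window_walk :: "nat \<Rightarrow> nat list \<Rightarrow> nat list list" where
  "window_walk b \<sigma> = map (\<lambda>i. factor i b \<sigma>) [0..<Suc (length \<sigma>) - b]"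

lemma length_window_walk: "length (window_walk b \<sigma>) = Suc (length \<sigma>) - b"
  by (simp add: window_walk_def)

lemma window_walk_nth: "i + b \<le> length \<sigma> \<Longrightarrow> window_walk b \<sigma> ! i = factor i b \<sigma>"
  unfolding window_walk_def by (subst nth_map) (simp_all del: upt_Suc)

lemma window_walk_not_Nil: "b \<le> length \<sigma> \<Longrightarrow> window_walk b \<sigma> \<noteq> []"
  by (simp add: window_walk_def)

lemma window_walk_factor:
  assumes "is_permutation \<sigma>" "i + k \<le> length \<sigma>" "b \<le> k"
  shows "window_walk b (factor i k \<sigma>) = take (Suc k - b) (drop i (window_walk b \<sigma>))"
proof (rule nth_equalityI)
  show "length (window_walk b (factor i k \<sigma>)) = length (take (Suc k - b) (drop i (window_walk b \<sigma>)))"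
    using assms by (simp add: length_window_walk length_factor)
next
  fix j assume "j < length (window_walk b (factor i k \<sigma>))"
  then have j: "j + b \<le> k" using assms(3) by (simp add: length_window_walk length_factor[OF assms(1,2)])
  then have "window_walk b (factor i k \<sigma>) ! j = factor (i + j) b \<sigma>"
    using assms by (simp add: window_walk_nth length_factor factor_factor)
  then show "window_walk b (factor i k \<sigma>) ! j = take (Suc k - b) (drop i (window_walk b \<sigma>)) ! j"
    using j assms by (simp add: window_walk_nth length_window_walk)
qed

lemma path_perms_iff:
  assumes "\<pi> \<noteq> []"
  shows "\<sigma> \<in> path_perms b \<pi> \<longleftrightarrow>
    is_permutation \<sigma> \<and> b \<le> length \<sigma> \<and> window_walk b \<sigma> = \<pi>"
proof -
  have win: "perm_of (window \<sigma> (Suc i) (Suc i + b - 1)) = factor i b \<sigma>" for i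
    by (simp add: window_eq_take_drop factor_def)
  have "(\<forall>i\<in>{1..length \<pi>}. perm_of (window \<sigma> i (i + b - 1)) = \<pi> ! (i - 1)) \<longleftrightarrow>
      (\<forall>i<length \<pi>. factor i b \<sigma> = \<pi> ! i)" (is "?L \<longleftrightarrow> ?R")
  proof
    assume L: ?L
    show ?R
    proof (intro allI impI)
      fix i assume "i < length \<pi>"
      then show "factor i b \<sigma> = \<pi> ! i" using bspec[OF L, of "Suc i"] win[of i] by simp
    qed
  next
    assume R: ?R
    show ?L
    proof
      fix i assume "i \<in> {1..length \<pi>}"
      then obtain j where "i = Suc j" "j < length \<pi>" by (cases i) auto
      then show "perm_of (window \<sigma> i (i + b - 1)) = \<pi> ! (i - 1)" using R win[of j] by simp
    qed
  qed
  moreover have "length \<sigma> = length \<pi> + b - 1 \<and> (\<forall>i<length \<pi>. factor i b \<sigma> = \<pi> ! i) \<longleftrightarrow>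
      b \<le> length \<sigma> \<and> window_walk b \<sigma> = \<pi>" (is "?L \<longleftrightarrow> ?R")
  proof
    assume L: ?L
    have "Suc (length \<sigma>) = length \<pi> + b" "0 < length \<pi>" using L assms by (cases \<pi>; simp)+
    then have b: "b \<le> length \<sigma>" "length (window_walk b \<sigma>) = length \<pi>"
      unfolding length_window_walk by linarith+
    moreover have "window_walk b \<sigma> = \<pi>"
    proof (rule nth_equalityI)
      fix i assume "i < length (window_walk b \<sigma>)"
      then show "window_walk b \<sigma> ! i = \<pi> ! i" using L b by (simp add: window_walk_nth length_window_walk)
    qed (rule b(2))
    ultimately show ?R by blast
  next
    assume R: ?R
    then have "length \<pi> = Suc (length \<sigma>) - b" using length_window_walk[of b \<sigma>] by simp
    moreover have "factor i b \<sigma> = \<pi> ! i" if "i < length \<pi>" for i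
      using R that window_walk_nth[of i b \<sigma>] calculation by simp
    ultimately show ?L using R by simp
  qed
  ultimately show ?thesis unfolding path_perms_def by blast
qed

section \<open>Permutations in the class and walks in the factor graph\<close>

locale infinite_finitely_based =
  fixes C :: "nat list set" and b :: nat
  assumes dc: "downward_closed C"
    and inf: "infinite C"
    and fb: "finitely_based C"
    and b_def: "b = Max (length ` basis C)"
begin

definition "V = {\<sigma> \<in> C. length \<sigma> = b}"

definition "E = parcs (factor_graph b C)"

lemma pverts_eq: "pverts (factor_graph b C) = V"
  by (simp add: factor_graph_def V_def Let_def)

lemma E_subset: "E \<subseteq> V \<times> V"
  by (auto simp: E_def V_def factor_graph_def Let_def)

lemma perm: "\<sigma> \<in> C \<Longrightarrow> is_permutation \<sigma>"
  using dc by (auto simp: downward_closed_def)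

lemma down: "\<tau> \<in> C \<Longrightarrow> is_permutation \<sigma> \<Longrightarrow> \<sigma> \<le>\<^sub>f \<tau> \<Longrightarrow> \<sigma> \<in> C"
  using dc unfolding downward_closed_def by blast

lemma factor_in: "\<sigma> \<in> C \<Longrightarrow> i + k \<le> length \<sigma> \<Longrightarrow> factor i k \<sigma> \<in> C"
  using down factor_le is_permutation_factor perm by blast

lemma basis_length: "\<beta> \<in> basis C \<Longrightarrow> length \<beta> \<le> b"
  using fb by (simp add: b_def finitely_based_def)

text \<open>
  The empty permutation is in \<open>C\<close> because \<open>C\<close> is nonempty, so it is not a basis element.
\<close>

lemma b_pos: "1 \<le> b"
proof -
  obtain \<beta> where \<beta>: "\<beta> \<in> basis C" using fb by (auto simp: finitely_based_def)
  obtain \<sigma> where "\<sigma> \<in> C" using inf by (metis ex_in_conv finite.emptyI)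
  then have "factor 0 0 \<sigma> \<in> C" by (rule factor_in) simp
  moreover have "factor 0 0 \<sigma> = []"
    using length_factor[OF perm[OF \<open>\<sigma> \<in> C\<close>], of 0 0] by simp
  ultimately have "\<beta> \<noteq> []" using \<beta> by (auto simp: basis_def)
  then show ?thesis using basis_length[OF \<beta>] by (cases \<beta>) auto
qed

lemma basis_below:
  assumes "is_permutation \<sigma>" "\<sigma> \<notin> C"
  obtains \<beta> where "\<beta> \<in> basis C" "\<beta> \<le>\<^sub>f \<sigma>"
  using assms
proof (induction "length \<sigma>" arbitrary: \<sigma> thesis rule: less_induct)
  case less
  show ?case
  proof (cases "\<sigma> \<in> basis C")
    case True
    then show ?thesis using less.prems contiguous_le_refl by blast
  next
    case False
    then obtain \<tau> where \<tau>: "is_permutation \<tau>" "\<tau> \<notin> C" "\<tau> \<le>\<^sub>f \<sigma>" "\<tau> \<noteq> \<sigma>"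
      using less.prems(2,3) by (auto simp: basis_def)
    have "length \<tau> \<noteq> length \<sigma>"
    proof
      assume len: "length \<tau> = length \<sigma>"
      obtain i where "i + length \<tau> \<le> length \<sigma>" "\<tau> = factor i (length \<tau>) \<sigma>"
        using \<tau>(3) by (auto simp: contiguous_le_iff_factor)
      then show False using len \<tau>(4) factor_all[OF less.prems(2)] by simp
    qed
    then have "length \<tau> < length \<sigma>" using contiguous_le_length[OF \<tau>(3)] by simp
    then obtain \<beta> where "\<beta> \<in> basis C" "\<beta> \<le>\<^sub>f \<tau>" using less.hyps \<tau>(1,2) by blast
    then show ?thesis using less.prems(1,2) contiguous_le_trans \<tau>(3) by blast
  qed
qed

text \<open>
  A basis element below \<open>\<sigma>\<close> has length at most \<open>b\<close>, so it would already be below a window of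
  length \<open>b\<close>.
\<close>

lemma mem_if_window_walk:
  assumes "is_permutation \<sigma>" "b \<le> length \<sigma>" "set (window_walk b \<sigma>) \<subseteq> C"
  shows "\<sigma> \<in> C"
proof (rule ccontr)
  assume "\<sigma> \<notin> C"
  then obtain \<beta> where \<beta>: "\<beta> \<in> basis C" "\<beta> \<le>\<^sub>f \<sigma>" using assms(1) basis_below by blast
  then obtain i where i: "i + b \<le> length \<sigma>" "\<beta> \<le>\<^sub>f factor i b \<sigma>"
    using le_some_factor[OF assms(1) _ basis_length assms(2)] by blast
  have "window_walk b \<sigma> ! i \<in> set (window_walk b \<sigma>)" using i(1) by (intro nth_mem) (simp add: length_window_walk)
  then have "factor i b \<sigma> \<in> C" using assms(3) i(1) by (auto simp: window_walk_nth)
  then show False using \<beta>(1) i(2) down by (auto simp: basis_def)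
qed

lemma edge_iff:
  "(\<sigma>, \<tau>) \<in> E \<longleftrightarrow> \<sigma> \<in> V \<and> \<tau> \<in> V \<and> factor 1 (b - 1) \<sigma> = factor 0 (b - 1) \<tau>"
  by (auto simp: E_def V_def factor_graph_def Let_def window_eq_take_drop factor_def)

lemma window_walk_in_walks:
  assumes "\<sigma> \<in> C" "b \<le> length \<sigma>"
  shows "window_walk b \<sigma> \<in> walks V E"
proof -
  have V: "factor i b \<sigma> \<in> V" if "i + b \<le> length \<sigma>" for i
    using factor_in[OF assms(1) that] length_factor[OF perm[OF assms(1)] that] by (simp add: V_def)
  have "(factor i b \<sigma>, factor (Suc i) b \<sigma>) \<in> E" if "Suc i + b \<le> length \<sigma>" for i
    using that b_pos V[of i] V[of "Suc i"] perm[OF assms(1)] by (simp add: edge_iff factor_factor)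
  then have "walk E (window_walk b \<sigma>)"
    by (auto simp: successively_conv_nth length_window_walk window_walk_nth)
  moreover have "set (window_walk b \<sigma>) \<subseteq> V"
    using V assms(2) by (auto simp: window_walk_def)
  ultimately show ?thesis using window_walk_not_Nil[OF assms(2)] by (simp add: walks_def)
qed

text \<open>
  An arc between the last window of \<open>x\<close> and the first window of \<open>y\<close> says that \<open>x\<close> and \<open>y\<close> can
  overlap in \<open>b - 1\<close> entries. With this overlap every window of length \<open>b\<close> of the amalgam lies in
  \<open>x\<close> or in \<open>y\<close>, so that the amalgam stays in \<open>C\<close> and its windows are those of \<open>x\<close> followed by those
  of \<open>y\<close>.
\<close>

lemma glue:
  assumes x: "x \<in> C" "b \<le> length x" and y: "y \<in> C" "b \<le> length y"
    and e: "(last (window_walk b x), hd (window_walk b y)) \<in> E"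
  obtains z where "z \<in> C" "window_walk b z = window_walk b x @ window_walk b y"
    "length z = length (window_walk b x) + length y"
    "factor 0 (length x) z = x" "factor (length (window_walk b x)) (length y) z = y"
proof -
  define n where "n = length (window_walk b x)"
  have n: "n = length x - (b - 1)" "n = Suc (length x) - b" "n + b = Suc (length x)"
    using b_pos x(2) by (simp_all add: n_def length_window_walk)
  note px = perm[OF x(1)] and py = perm[OF y(1)]
  have "last (window_walk b x) = factor (length x - b) b x"
    using x(2) window_walk_not_Nil[OF x(2)] by (simp add: last_conv_nth length_window_walk window_walk_nth)
  moreover have "hd (window_walk b y) = factor 0 b y"
    using y(2) window_walk_not_Nil[OF y(2)] by (simp add: hd_conv_nth window_walk_nth)
  ultimately have "factor 1 (b - 1) (factor (length x - b) b x) = factor 0 (b - 1) (factor 0 b y)"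
    using e by (simp add: edge_iff)
  moreover have "length x - b + 1 = n" using n(3) x(2) by simp
  ultimately have "factor n (b - 1) x = factor 0 (b - 1) y"
    using b_pos factor_factor[OF px, of 1 "b - 1" b "length x - b"]
      factor_factor[OF py, of 0 "b - 1" b 0] by simp
  moreover have "take (b - 1) (drop n x) = drop n x" using n(3) by simp
  ultimately have overlap: "perm_of (drop (length x - (b - 1)) x) = perm_of (take (b - 1) y)"
    by (simp add: factor_def n(1)[symmetric] del: One_nat_def)
  have "b - 1 \<le> length x" "b - 1 \<le> length y" using x(2) y(2) by simp_all
  from amalgamate[OF px py this overlap] obtain z where z: "is_permutation z"
      "length z = length x + length y - (b - 1)"
      "factor 0 (length x) z = x" "factor n (length y) z = y"
    unfolding n(1)[symmetric] by blast
  have len: "length z = n + length y" using z(2) n(3) x(2) b_pos by linarith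
  have trail: "window_walk b z = window_walk b x @ window_walk b y"
  proof (rule nth_equalityI)
    show len': "length (window_walk b z) = length (window_walk b x @ window_walk b y)"
      using len y(2) by (simp add: length_window_walk n_def)
    fix i assume "i < length (window_walk b z)"
    then have i: "i + b \<le> length z" using len y(2) by (simp add: length_window_walk)
    show "window_walk b z ! i = (window_walk b x @ window_walk b y) ! i"
    proof (cases "i < n")
      case True
      then have "factor i b x = factor i b z"
        using factor_factor[OF z(1), of i b "length x" 0] z(3) n(3) by simp
      moreover have "i + b \<le> length x" using True n(3) by simp
      ultimately show ?thesis using True i by (simp add: nth_append n_def[symmetric] window_walk_nth)
    next
      case False
      then have "factor (i - n) b y = factor i b z"
        using factor_factor[OF z(1), of "i - n" b "length y" n] z(4) i len by simp
      then show ?thesis using False i len by (simp add: nth_append n_def[symmetric] window_walk_nth)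
    qed
  qed
  have "set (window_walk b z) \<subseteq> C"
    using trail window_walk_in_walks[OF x] window_walk_in_walks[OF y] by (auto simp: walks_def V_def)
  then have "z \<in> C" using mem_if_window_walk[OF z(1)] len y(2) by simp
  then show thesis using that[of z] trail z(3,4) len by (simp add: n_def)
qed

lemma window_walk_vertex: "v \<in> V \<Longrightarrow> window_walk b v = [v]"
  using factor_all[OF perm] by (auto simp: V_def window_walk_def)

lemma walk_realized:
  assumes "w \<in> walks V E"
  obtains x where "x \<in> C" "b \<le> length x" "window_walk b x = w"
proof -
  have "\<exists>x\<in>C. b \<le> length x \<and> window_walk b x = w"
    using assms
  proof (induction w)
    case (Cons v w)
    have v: "v \<in> V" "v \<in> C" "b \<le> length v" using Cons.prems by (auto simp: walks_def V_def)
    show ?case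
    proof (cases "w = []")
      case True
      then show ?thesis using v window_walk_vertex by blast
    next
      case False
      then have "w \<in> walks V E" "(v, hd w) \<in> E"
        using Cons.prems by (auto simp: walks_def successively_Cons)
      then obtain x where x: "x \<in> C" "b \<le> length x" "window_walk b x = w" using Cons.IH by blast
      then obtain z where "z \<in> C" "window_walk b z = [v] @ w" "length z = length [v] + length x"
        using glue[OF v(2,3) x(1,2)] window_walk_vertex[OF v(1)] \<open>(v, hd w) \<in> E\<close> by auto
      then show ?thesis using x(2) by (intro bexI[of _ z]) simp_all
    qed
  qed (simp add: walks_def)
  then show thesis using that by blast
qed

text \<open>
  Not just some permutation with the longer walk is obtained, but one that contains the given \<open>x\<close>
  in the place of its windows.
\<close>

lemma extend_realization:
  assumes x: "x \<in> C" "b \<le> length x" and w: "walk E (a @ window_walk b x @ c)"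
  obtains z where "z \<in> C" "b \<le> length z" "window_walk b z = a @ window_walk b x @ c"
    "length a + length x \<le> length z" "factor (length a) (length x) z = x"
proof -
  have tx: "window_walk b x \<noteq> []" using window_walk_not_Nil[OF x(2)] .
  have "a @ window_walk b x @ c \<in> walks V E"
    using walk_extend_in_walks[OF E_subset window_walk_in_walks[OF x] w] .
  then have ac: "a = [] \<or> a \<in> walks V E" "c = [] \<or> c \<in> walks V E"
    by (auto simp: walks_def successively_append_iff)
  obtain y where y: "y \<in> C" "b \<le> length y" "window_walk b y = a @ window_walk b x"
      "length y = length a + length x" "factor (length a) (length x) y = x"
  proof (cases "a = []")
    case True
    then show thesis using that[of x] x factor_all[OF perm[OF x(1)]] by simp
  next
    case False
    then obtain u where u: "u \<in> C" "b \<le> length u" "window_walk b u = a"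
      using ac(1) walk_realized by blast
    have "(last (window_walk b u), hd (window_walk b x)) \<in> E"
      using w False tx u(3) by (simp add: successively_append_iff)
    from glue[OF u(1,2) x this] obtain y where "y \<in> C" "window_walk b y = a @ window_walk b x"
      "length y = length a + length x" "factor (length a) (length x) y = x"
      unfolding u(3) by blast
    then show thesis using that[of y] x(2) by simp
  qed
  show thesis
  proof (cases "c = []")
    case True
    then show thesis using that[of y] y by simp
  next
    case False
    then obtain u where u: "u \<in> C" "b \<le> length u" "window_walk b u = c"
      using ac(2) walk_realized by blast
    have "(last (window_walk b y), hd (window_walk b u)) \<in> E"
      using w False tx y(3) u(3) by (simp add: successively_append_iff)
    from glue[OF y(1,2) u(1,2) this] obtain z where z: "z \<in> C" "window_walk b z = window_walk b y @ c"
      "length z = length (window_walk b y) + length u" "factor 0 (length y) z = y"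
      unfolding u(3) by blast
    have len: "length y \<le> length z"
      using z(3) u(2) y(2) by (simp add: length_window_walk)
    have "factor (length a) (length x) z = factor (length a) (length x) y"
      using factor_factor[OF perm[OF z(1)], of "length a" "length x" "length y" 0] z(4) y(4) by simp
    then show thesis using that[of z] z y len by simp
  qed
qed

lemma window_walk_of_le:
  assumes z: "z \<in> C" and x: "b \<le> length x" "x \<le>\<^sub>f z"
  obtains a c where "window_walk b z = a @ window_walk b x @ c" "x = factor (length a) (length x) z"
proof -
  obtain i where i: "i + length x \<le> length z" "x = factor i (length x) z"
    using x(2) by (auto simp: contiguous_le_iff_factor)
  define n where "n = Suc (length x) - b"
  have "window_walk b x = take n (drop i (window_walk b z))"
    using window_walk_factor[OF perm[OF z] i(1) x(1)] i(2) by (simp add: n_def)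
  then have "window_walk b z = take i (window_walk b z) @ window_walk b x @ drop n (drop i (window_walk b z))"
    by (metis append_take_drop_id)
  moreover have "length (take i (window_walk b z)) = i" using i(1) x(1) by (simp add: length_window_walk)
  ultimately show thesis using that i(2) by metis
qed

lemma finite_short: "finite {\<sigma> \<in> C. length \<sigma> \<le> n}"
proof (rule finite_subset)
  show "{\<sigma> \<in> C. length \<sigma> \<le> n} \<subseteq> (\<Union>k\<le>n. {\<sigma>. is_permutation \<sigma> \<and> length \<sigma> = k})"
    using perm by auto
qed (simp add: finite_permutations_length)

lemma long_element: obtains \<sigma> where "\<sigma> \<in> C" "n < length \<sigma>"
proof -
  have "C \<noteq> {\<sigma> \<in> C. length \<sigma> \<le> n}" using finite_short[of n] inf by metis
  then obtain \<sigma> where "\<sigma> \<in> C" "\<not> length \<sigma> \<le> n" by blast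
  then show thesis using that by simp
qed

lemma finite_V: "finite V"
  by (rule finite_subset[OF _ finite_short[of b]]) (auto simp: V_def)

text \<open>
  A strongly connected graph could be a single vertex without a loop. This is excluded because the
  infinite set \<open>C\<close> has members longer than \<open>b\<close>, and these yield arcs.
\<close>

lemma edge_exists: obtains u v where "(u, v) \<in> E"
proof -
  obtain \<sigma> where s: "\<sigma> \<in> C" "b < length \<sigma>" by (rule long_element)
  have "walk E (window_walk b \<sigma>)" using s window_walk_in_walks[of \<sigma>] by (simp add: walks_def)
  moreover have "Suc 0 < length (window_walk b \<sigma>)" using s(2) by (simp add: length_window_walk)
  ultimately have "(window_walk b \<sigma> ! 0, window_walk b \<sigma> ! Suc 0) \<in> E" by (rule successively_nth)
  then show thesis using that by blast
qed

lemma strongly_connected_iff: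
  "strongly_connected (with_proj (factor_graph b C)) \<longleftrightarrow> (\<forall>u\<in>V. \<forall>v\<in>V. (u, v) \<in> E\<^sup>*)"
proof -
  have "V \<noteq> {}" using edge_exists E_subset by blast
  moreover have "(u, v) \<in> rtrancl_on V E \<longleftrightarrow> (u, v) \<in> E\<^sup>*" if "u \<in> V" for u v
  proof
    assume "(u, v) \<in> E\<^sup>*"
    then show "(u, v) \<in> rtrancl_on V E"
    proof induction
      case (step y z)
      then show ?case using E_subset by (blast intro: rtrancl_on_into_rtrancl_on)
    qed (use that in simp)
  qed (rule rtrancl_on_rtranclI)
  ultimately show ?thesis
    by (simp add: strongly_connected_def reachable_def pverts_eq E_def[symmetric])
qed

lemma vwalk_iff: "vwalk \<pi> (with_proj (factor_graph b C)) \<longleftrightarrow> \<pi> \<in> walks V E"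
  by (simp add: vwalk_iff_walks pverts_eq E_def)

lemma finite_path_perms: "finite (path_perms b \<pi>)"
  by (rule finite_subset[OF _ finite_permutations_length[of "length \<pi> + b - 1"]])
    (auto simp: path_perms_def)

lemma not_ambiguous_iff:
  "\<not> ambiguous b \<pi> \<longleftrightarrow> (\<forall>\<sigma>\<in>path_perms b \<pi>. \<forall>\<tau>\<in>path_perms b \<pi>. \<sigma> = \<tau>)"
  using card_le_Suc0_iff_eq[OF finite_path_perms[of \<pi>]] by (simp add: ambiguous_def not_less)

definition extendable where
  "extendable \<longleftrightarrow> (\<forall>\<sigma>\<in>C. length \<sigma> < b \<longrightarrow> (\<exists>\<rho>\<in>C. length \<rho> = b \<and> \<sigma> \<le>\<^sub>f \<rho>))"

section \<open>Joint embedding and the factor graph\<close>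

text \<open>
  A common upper bound of \<open>\<sigma>\<close> and a member longer than \<open>b\<close> has length at least \<open>b\<close>, so that one of
  its windows of length \<open>b\<close> contains \<open>\<sigma>\<close>.
\<close>

lemma joint_embedding_imp_extendable:
  assumes "joint_embedding C"
  shows extendable
  unfolding extendable_def
proof (intro ballI impI)
  fix \<sigma> assume s: "\<sigma> \<in> C" "length \<sigma> < b"
  obtain y where y: "y \<in> C" "b < length y" by (rule long_element)
  then obtain z where z: "z \<in> C" "\<sigma> \<le>\<^sub>f z" "y \<le>\<^sub>f z"
    using assms s by (auto simp: joint_embedding_def)
  then have "b \<le> length z" using y(2) contiguous_le_length[of y z] by simp
  then obtain i where "i + b \<le> length z" "\<sigma> \<le>\<^sub>f factor i b z"
    using le_some_factor[OF perm[OF z(1)] z(2)] s(2) by (metis less_imp_le)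
  then show "\<exists>\<rho>\<in>C. length \<rho> = b \<and> \<sigma> \<le>\<^sub>f \<rho>"
    using factor_in[OF z(1)] length_factor[OF perm[OF z(1)]] by blast
qed

lemma joint_embedding_imp_joint_walks:
  assumes "joint_embedding C"
  shows "joint_walks V E"
  unfolding joint_walks_def
proof (intro ballI)
  fix w\<^sub>1 w\<^sub>2 assume "w\<^sub>1 \<in> walks V E" "w\<^sub>2 \<in> walks V E"
  then obtain x y where x: "x \<in> C" "b \<le> length x" "window_walk b x = w\<^sub>1"
    and y: "y \<in> C" "b \<le> length y" "window_walk b y = w\<^sub>2"
    using walk_realized by metis
  obtain z where z: "z \<in> C" "x \<le>\<^sub>f z" "y \<le>\<^sub>f z"
    using assms x(1) y(1) by (auto simp: joint_embedding_def)
  have "b \<le> length z" using x(2) contiguous_le_length[OF z(2)] by simp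
  then have "window_walk b z \<in> walks V E" using window_walk_in_walks z(1) by blast
  moreover have "sublist w\<^sub>1 (window_walk b z)" "sublist w\<^sub>2 (window_walk b z)"
    using window_walk_of_le[OF z(1) x(2) z(2)] window_walk_of_le[OF z(1) y(2) z(3)] x(3) y(3)
    by (metis sublist_appendI)+
  ultimately show "\<exists>w\<in>walks V E. sublist w\<^sub>1 w \<and> sublist w\<^sub>2 w" by blast
qed

text \<open>
  Two permutations \<open>\<sigma>\<close> and \<open>\<tau>\<close> on the walk \<open>\<pi>\<close> extend to permutations \<open>x\<close> and \<open>y\<close> on the
  same walk through the bridge. In a common upper bound of \<open>x\<close> and \<open>y\<close> this walk occurs at the
  places of \<open>x\<close> and of \<open>y\<close>; as the bridge is passed only once, the two places coincide, and so
  do \<open>x\<close> and \<open>y\<close>.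
\<close>

lemma joint_embedding_imp_not_ambiguous:
  assumes J: "joint_embedding C" and T: "thin_bridge V E s t" and \<pi>: "\<pi> \<in> walks V E"
  shows "\<not> ambiguous b \<pi>"
  unfolding not_ambiguous_iff
proof (intro ballI)
  fix \<sigma> \<tau> assume "\<sigma> \<in> path_perms b \<pi>" "\<tau> \<in> path_perms b \<pi>"
  moreover have "\<pi> \<noteq> []" "set \<pi> \<subseteq> C" using \<pi> by (auto simp: walks_def V_def)
  ultimately have \<sigma>: "\<sigma> \<in> C" "b \<le> length \<sigma>" "window_walk b \<sigma> = \<pi>"
    and \<tau>: "\<tau> \<in> C" "b \<le> length \<tau>" "window_walk b \<tau> = \<pi>"
    using mem_if_window_walk by (auto simp: path_perms_iff)
  have len: "length \<sigma> = length \<tau>"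
    using \<sigma>(2,3) \<tau>(2,3) length_window_walk[of b \<sigma>] length_window_walk[of b \<tau>] by simp
  obtain d e where de: "walk E (d @ s # t # e)" "sublist \<pi> (d @ s # t # e)"
    using thin_bridge_walk_extends[OF T \<pi>] by blast
  then obtain a c where ac: "d @ s # t # e = a @ \<pi> @ c" by (auto simp: sublist_def)
  have w: "walk E (a @ window_walk b \<sigma> @ c)" "walk E (a @ window_walk b \<tau> @ c)"
    using de(1) ac \<sigma>(3) \<tau>(3) by simp_all
  obtain x where x: "x \<in> C" "b \<le> length x" "window_walk b x = d @ s # t # e"
      "factor (length a) (length \<sigma>) x = \<sigma>"
    using extend_realization[OF \<sigma>(1,2) w(1)] ac \<sigma>(3) by metis
  obtain y where y: "y \<in> C" "b \<le> length y" "window_walk b y = d @ s # t # e"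
      "factor (length a) (length \<tau>) y = \<tau>"
    using extend_realization[OF \<tau>(1,2) w(2)] ac \<tau>(3) by metis
  have len': "length x = length y"
    using x(2,3) y(2,3) length_window_walk[of b x] length_window_walk[of b y] by simp
  obtain z where z: "z \<in> C" "x \<le>\<^sub>f z" "y \<le>\<^sub>f z"
    using J x(1) y(1) by (auto simp: joint_embedding_def)
  obtain f g where fg: "window_walk b z = f @ (d @ s # t # e) @ g" "x = factor (length f) (length x) z"
    using window_walk_of_le[OF z(1) x(2) z(2)] unfolding x(3) by blast
  obtain f' g' where fg': "window_walk b z = f' @ (d @ s # t # e) @ g'" "y = factor (length f') (length y) z"
    using window_walk_of_le[OF z(1) y(2) z(3)] unfolding y(3) by blast
  have "(f @ d) @ s # t # (e @ g) = (f' @ d) @ s # t # (e @ g')" using fg(1) fg'(1) by simp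
  moreover have "walk E ((f @ d) @ s # t # (e @ g))"
  proof -
    have "b \<le> length z" using x(2) contiguous_le_length[OF z(2)] by simp
    then have "walk E (window_walk b z)" using window_walk_in_walks[OF z(1)] by (simp add: walks_def)
    then show ?thesis using fg(1) by simp
  qed
  moreover have "(t, s) \<notin> E\<^sup>*" using T by (simp add: thin_bridge_def)
  ultimately have "f @ d = f' @ d" using bridge_once by metis
  then have "x = y" using fg(2) fg'(2) len' by simp
  then show "\<sigma> = \<tau>" using x(4) y(4) len by metis
qed

lemma joint_embedding_if_long:
  assumes extendable
    and long: "\<And>x y. x \<in> C \<Longrightarrow> y \<in> C \<Longrightarrow> b \<le> length x \<Longrightarrow> b \<le> length y \<Longrightarrow>
      \<exists>z\<in>C. x \<le>\<^sub>f z \<and> y \<le>\<^sub>f z"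
  shows "joint_embedding C"
  unfolding joint_embedding_def
proof (intro ballI)
  have ext: "\<exists>x'\<in>C. b \<le> length x' \<and> x \<le>\<^sub>f x'" if "x \<in> C" for x
  proof (cases "length x < b")
    case True
    then show ?thesis using assms(1) that unfolding extendable_def by (metis order_refl)
  next
    case False
    then show ?thesis using that contiguous_le_refl[OF perm[OF that]] by (auto simp: not_less)
  qed
  fix x y assume "x \<in> C" "y \<in> C"
  then obtain x' y' where "x' \<in> C" "b \<le> length x'" "x \<le>\<^sub>f x'" "y' \<in> C" "b \<le> length y'" "y \<le>\<^sub>f y'"
    using ext by meson
  moreover from this obtain z where "z \<in> C" "x' \<le>\<^sub>f z" "y' \<le>\<^sub>f z" using long by meson
  ultimately show "\<exists>z\<in>C. x \<le>\<^sub>f z \<and> y \<le>\<^sub>f z" using contiguous_le_trans perm by meson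
qed

text \<open>
  The permutation \<open>x\<close> is prolonged along a walk from its last window to a predecessor of the first
  window of \<open>y\<close> and then glued to \<open>y\<close>.
\<close>

lemma strongly_connected_imp_joint_embedding:
  assumes S: "\<forall>u\<in>V. \<forall>v\<in>V. (u, v) \<in> E\<^sup>*" and extendable
  shows "joint_embedding C"
proof (rule joint_embedding_if_long[OF assms(2)])
  fix x y assume x: "x \<in> C" "b \<le> length x" and y: "y \<in> C" "b \<le> length y"
  have wx: "window_walk b x \<in> walks V E" and wy: "window_walk b y \<in> walks V E"
    using window_walk_in_walks x y by blast+
  \<comment> \<open>The detour through some arc ensures that the connection is not the empty walk, for which
    gluing would not apply.\<close>
  obtain u v where uv: "(u, v) \<in> E" by (rule edge_exists)
  define p q where "p = last (window_walk b x)" and "q = hd (window_walk b y)"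
  have pq: "p \<in> V" "q \<in> V" using wx wy by (auto simp: p_def q_def walks_def)
  have "(p, u) \<in> E\<^sup>*" "(v, q) \<in> E\<^sup>*" using S pq uv E_subset by blast+
  then obtain r where r: "(p, r) \<in> E\<^sup>*" "(r, q) \<in> E"
    using uv by (metis rtrancl_into_trancl1 rtrancl_trancl_trancl rtranclD trancl_trans tranclD2 trancl.r_into_trancl)
  then obtain m where m: "walk E (p # m)" "last (p # m) = r" using rtrancl_walk by metis
  have "walk E (window_walk b x @ m)" "last (window_walk b x @ m) = r"
    using wx m by (auto simp: p_def walks_def successively_append_iff successively_Cons split: if_splits)
  then obtain z where z: "z \<in> C" "b \<le> length z" "window_walk b z = window_walk b x @ m"
      "length x \<le> length z" "factor 0 (length x) z = x" "last (window_walk b z) = r"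
    using extend_realization[OF x, of "[]" m] by auto
  have "(last (window_walk b z), hd (window_walk b y)) \<in> E" using r(2) z(6) by (simp add: q_def)
  from glue[OF z(1,2) y this] obtain z' where z': "z' \<in> C"
    "length z' = length (window_walk b z) + length y" "factor 0 (length z) z' = z"
    "factor (length (window_walk b z)) (length y) z' = y" by blast
  note pz = perm[OF z(1)] and pz' = perm[OF z'(1)]
  have "length z \<le> length z'" using z'(2) y(2) z(2) by (simp add: length_window_walk)
  then have "z \<le>\<^sub>f z'" using factor_le[OF pz', of 0 "length z"] z'(3) by simp
  moreover have "y \<le>\<^sub>f z'"
    using factor_le[OF pz', of "length (window_walk b z)" "length y"] z'(2,4) by simp
  moreover have "x \<le>\<^sub>f z" using factor_le[OF pz, of 0 "length x"] z(4,5) by simp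
  ultimately show "\<exists>z\<in>C. x \<le>\<^sub>f z \<and> y \<le>\<^sub>f z" using z'(1) contiguous_le_trans pz' by blast
qed

text \<open>
  A member that realises a common walk of the windows of \<open>x\<close> and \<open>y\<close> has factors with the
  same windows as \<open>x\<close> and \<open>y\<close>, and these factors are \<open>x\<close> and \<open>y\<close> for lack of ambiguity.
\<close>

lemma unambiguous_imp_joint_embedding:
  assumes J: "joint_walks V E" and U: "\<And>\<pi>. \<pi> \<in> walks V E \<Longrightarrow> \<not> ambiguous b \<pi>" and extendable
  shows "joint_embedding C"
proof (rule joint_embedding_if_long[OF assms(3)])
  fix x y assume x: "x \<in> C" "b \<le> length x" and y: "y \<in> C" "b \<le> length y"
  obtain w where w: "w \<in> walks V E" "sublist (window_walk b x) w" "sublist (window_walk b y) w"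
    using joint_walksE[OF J window_walk_in_walks[OF x] window_walk_in_walks[OF y]] by metis
  then obtain z where z: "z \<in> C" "b \<le> length z" "window_walk b z = w" using walk_realized by metis
  have below: "u \<le>\<^sub>f z" if u: "u \<in> C" "b \<le> length u" and sub: "sublist (window_walk b u) w" for u
  proof -
    obtain a c where ac: "window_walk b z = a @ window_walk b u @ c" using sub z(3) by (auto simp: sublist_def)
    define u' where "u' = factor (length a) (length u) z"
    have fit: "length a + length u \<le> length z"
      using arg_cong[OF ac, of length] u(2) z(2) by (simp add: length_window_walk)
    have "window_walk b u' = window_walk b u"
      using window_walk_factor[OF perm[OF z(1)] fit u(2)] ac by (simp add: u'_def length_window_walk)
    then have "u' \<in> path_perms b (window_walk b u)" "u \<in> path_perms b (window_walk b u)"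
      using window_walk_not_Nil[OF u(2)] perm[OF u(1)] u(2) is_permutation_factor[OF perm[OF z(1)]]
        length_factor[OF perm[OF z(1)] fit] by (simp_all add: path_perms_iff u'_def)
    then have "u' = u" using U[OF window_walk_in_walks[OF u]] unfolding not_ambiguous_iff by blast
    then show ?thesis using factor_le[OF perm[OF z(1)] fit] by (simp add: u'_def)
  qed
  then show "\<exists>z\<in>C. x \<le>\<^sub>f z \<and> y \<le>\<^sub>f z" using x y w z(1) by blast
qed

end

theorem theorem6p7:
  fixes C :: "nat list set" and b :: nat
  assumes "downward_closed C"
    and "infinite C"
    and "finitely_based C"
    and "b = Max (length ` basis C)"
  shows "atomic C \<longleftrightarrow>
    (strongly_connected (with_proj (factor_graph b C)) \<or>
      bicycle (factor_graph b C) \<and>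
      (\<forall>\<pi>. vwalk \<pi> (with_proj (factor_graph b C)) \<longrightarrow> \<not> ambiguous b \<pi>)) \<and>
    (\<forall>\<sigma>\<in>C. length \<sigma> < b \<longrightarrow> (\<exists>\<rho>\<in>C. length \<rho> = b \<and> \<sigma> \<le>\<^sub>f \<rho>))"
proof -
  interpret infinite_finitely_based C b using assms by unfold_locales
  have "joint_embedding C \<longleftrightarrow> ((\<forall>u\<in>V. \<forall>v\<in>V. (u, v) \<in> E\<^sup>*) \<or>
      bicycle (factor_graph b C) \<and> (\<forall>\<pi>\<in>walks V E. \<not> ambiguous b \<pi>)) \<and> extendable"
    (is "_ \<longleftrightarrow> (?S \<or> ?B \<and> ?U) \<and> _")
  proof (intro iffI conjI)
    assume J: "joint_embedding C"
    show extendable using J by (rule joint_embedding_imp_extendable)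
    show "?S \<or> ?B \<and> ?U"
    proof (cases ?S)
      case True
      then show ?thesis by (rule disjI1)
    next
      case False
      then obtain u v where uv: "u \<in> V" "v \<in> V" "(u, v) \<notin> E\<^sup>*" by blast
      obtain s t where T: "thin_bridge V E s t"
        by (rule joint_walks_imp_thin_bridge[OF E_subset joint_embedding_imp_joint_walks[OF J] uv])
      have ?B
        using thin_bridge_imp_bicycle[of "factor_graph b C" s t] T E_subset finite_V
        unfolding pverts_eq E_def[symmetric] by blast
      moreover have ?U
        using joint_embedding_imp_not_ambiguous[OF J T] by blast
      ultimately show ?thesis by blast
    qed
  next
    assume R: "(?S \<or> ?B \<and> ?U) \<and> extendable"
    show "joint_embedding C"
    proof (cases ?S)
      case True
      then show ?thesis using R strongly_connected_imp_joint_embedding by blast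
    next
      case False
      then obtain s t where "thin_bridge V E s t"
        using R bicycle_imp_strong_or_thin_bridge[of "factor_graph b C"]
        unfolding pverts_eq E_def[symmetric] by blast
      then have "joint_walks V E" by (rule thin_bridge_imp_joint_walks[OF E_subset])
      then show ?thesis using R False unambiguous_imp_joint_embedding by blast
    qed
  qed
  then show ?thesis
    unfolding atomic_iff_joint_embedding[OF assms(1)] strongly_connected_iff vwalk_iff
      extendable_def by blast
qed

end
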